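(* Let $e \in \mathrm{Expr}$, $\sigma \in \mathrm{State}$ and let $\mu$ be a distribution on $\mathrm{Val}\times\mathrm{State}$. Then both of the following hold: (1) If $e, \sigma \Downarrow_{\mathrm{std}} \mu$, then there exist a probability space $\psi$ over $\Omega$ and a random configuration variable $C : \Omega \to \mathrm{Expr}\times\mathrm{State}$ such that $\mu = \mu_\psi \circ C^{-1}$ (the push-forward of the measure of $\psi$ along $C$) and $(\psi_0, \lambda\rho.(e,\sigma)) \Downarrow (\psi, C)$. (2) If $(\psi_0, \lambda\rho.(e,\sigma)) \Downarrow (\psi, C)$, then $e, \sigma \Downarrow_{\mathrm{std}} \mu_\psi \circ C^{-1}$.
   Context: A language is given by sets $\mathrm{Expr}$, $\mathrm{Val} \subseteq \mathrm{Expr}$, $\mathrm{State}$ and a single-step relation $e,\sigma \leadsto e_1,\sigma_1,e_2,\sigma_2,p$ (with $0 < p \le 1$), read "$e,\sigma$ steps to $e_1,\sigma_1$ with probability $p$ and to $e_2,\sigma_2$ with probability $1-p$"; deterministic steps $e,\sigma \to e',\sigma'$ are represented as $e,\sigma \leadsto e',\sigma',e_2,\sigma_2,1$ for all $e_2,\sigma_2$. Standard semantics $\Downarrow_{\mathrm{std}} \subseteq (\mathrm{Expr}\times\mathrm{State}) \times \mathcal{D}(\mathrm{Val}\times\mathrm{State})$ is inductively defined by: $v,\sigma \Downarrow_{\mathrm{std}} \delta_{(v,\sigma)}$ for $v \in \mathrm{Val}$; if $e,\sigma \leadsto e_1,\sigma_1,\_,\_,1$ and $e_1,\sigma_1 \Downarrow_{\mathrm{std}}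 \mu$ then $e,\sigma \Downarrow_{\mathrm{std}} \mu$; if $e,\sigma\leadsto e_1,\sigma_1,e_2,\sigma_2,p$, $e_1,\sigma_1\Downarrow_{\mathrm{std}}\mu_1$ and $e_2,\sigma_2 \Downarrow_{\mathrm{std}} \mu_2$ then $e,\sigma \Downarrow_{\mathrm{std}} p\mu_1 + (1-p)\mu_2$. Probability spaces: fix a countable set $\mathrm{Rid}$ of randomness identifiers and $\Omega = \mathrm{Rid}\to\mathrm{Bool}$. All probability spaces are complete probability spaces over $\Omega$ that carry information only about finitely many identifiers, i.e. are of the form $\psi_R \otimes \mathrm{Triv}$ for a finite $R\subseteq\mathrm{Rid}$, where $\mathrm{Triv}$ is the trivial space (σ-algebra $\{\emptyset, \text{whole space}\}$) on $(\mathrm{Rid}\setminus R)\to\mathrm{Bool}$. $\psi_0$ denotes the trivial probability space on $\Omega$. An atom of $\psi$ is an event of nonzero probability all of whose measurable subevents have probability $0$; $\mathrm{atoms}(\psi)$ is the set of atoms. For an event $Y$ with $\mu_\psi(Y)>0$, $\psi|_Y$ has the same σ-algebra and measure $E\mapsto \mu_\psi(E\cap Y)/\mu_\psi(Y)$. The independent product $\psi_1\cdot\psi_2$ is the probability space on the σ-algebra generated by both σ-algebras with $\mu(E_1\cap E_2)=\mu_1(E_1)\mu_2(E_2)$. For a finitely supported distribution $\nu$ on a set $A$ and a family $\kappa(a)$ of probability spaces with pairwise disjoint supports for $a\in\mathrm{supp}\,\nu$ (support of a space: complement of the union of its null events), $\mathrm{wsum}(\nu,\kappa)$ is the space with σ-algebra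 $\bigcap_{a\in\mathrm{supp}\,\nu}\mathcal{F}_{\kappa(a)}$ and measure $E\mapsto\sum_a \nu(a)\kappa(a)(E)$. For $r\in\mathrm{Rid}$, $\mathrm{Ber}_r(p)$ denotes the probability space whose σ-algebra is generated by the event $\{\rho \mid \rho(r)=\mathrm{true}\}$, which has probability $p$. One-step relation on pairs $(\psi, C)$ with $C:\Omega\to\mathrm{Expr}\times\mathrm{State}$: $(\psi_1,C_1)\to(\psi_2,C_2)$ iff there exist $X, r, e_1,\sigma_1,e_2,\sigma_2,p$ with: $X\in\mathrm{atoms}(\psi_1)$; $\psi_1 = \psi_1'\otimes\mathrm{Triv}(\{r\}\to\mathrm{Bool})$ for some $\psi_1'$ (so $\psi_1$ carries no information on $r$); $\psi_2 = \mathrm{wsum}(\nu, \lambda Y.\ \psi_1|_Y \cdot (\text{if } X = Y \text{ then } \mathrm{Ber}_r(p) \text{ else the trivial space}))$ where $\nu$ is the distribution on $\mathrm{atoms}(\psi_1)$ assigning $Y$ probability $\mu_{\psi_1}(Y)$; for all $\rho\in X$, $C_1(\rho)\leadsto e_1,\sigma_1,e_2,\sigma_2,p$; for all $\rho\in X$, $C_2(\rho[r\mapsto\mathrm{true}]) = (e_1,\sigma_1)$ and, if $p\ne1$, $C_2(\rho[r\mapsto\mathrm{false}])=(e_2,\sigma_2)$; and for all $Y\in\mathrm{atoms}(\psi_1)$ with $Y\neq X$ and all $\rho\in Y$, $C_1(\rho)=C_2(\rho)$. The collecting big-step relation $\Downarrow$ is inductively defined: if $\{\rho \mid C_1(\rho)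 = C_2(\rho)\}$ has probability $1$ in $\psi$ and $C_2(\rho)\in\mathrm{Val}\times\mathrm{State}$ for all $\rho$, then $(\psi, C_1)\Downarrow(\psi, C_2)$; if $(\psi_1,C_1)\to(\psi_2,C_2)$ and $(\psi_2,C_2)\Downarrow(\psi_3,C_3)$ then $(\psi_1,C_1)\Downarrow(\psi_3,C_3)$.
   Formalization: Rid is taken to be infinite (with finite Rid, (1) fails when identifiers run out); atoms use proper subevents (else none exist); products with Triv, the spaces ψ|_Y and Ber_r(p) are completed, since otherwise wsum forgets the fresh bit. *)

theory Defs
  imports "HOL-Probability.Probability"
begin

section \<open>Languages and the standard semantics\<close>

text \<open>
  The sets of expressions and states are the types \<open>'e\<close> and \<open>'s\<close>. \<open>step c c1 c2 p\<close> reads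
  ``\<open>c\<close> steps to \<open>c1\<close> with probability \<open>p\<close> and to \<open>c2\<close> with probability \<open>1 - p\<close>''. A
  deterministic step from \<open>c\<close> to \<open>c1\<close> is represented by \<open>step c c1 c2 1\<close> for all \<open>c2\<close>. As
  \<open>c2\<close> never contributes to a result when \<open>p = 1\<close>, no closure condition is imposed on \<open>step\<close>.
\<close>

type_synonym ('e, 's) config = "'e \<times> 's"

type_synonym ('e, 's) step_rel =
  "('e, 's) config \<Rightarrow> ('e, 's) config \<Rightarrow> ('e, 's) config \<Rightarrow> real \<Rightarrow> bool"

locale language =
  fixes step :: "('e, 's) step_rel"
  assumes step_prob: "step c c1 c2 p \<Longrightarrow> 0 < p \<and> p \<le> 1"

definition mix_pmf :: "real \<Rightarrow> 'a pmf \<Rightarrow> 'a pmf \<Rightarrow> 'a pmf" where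
  "mix_pmf p \<mu>1 \<mu>2 = bind_pmf (bernoulli_pmf p) (\<lambda>b. if b then \<mu>1 else \<mu>2)"

inductive std_bigstep ::
    "'e set \<Rightarrow> ('e, 's) step_rel \<Rightarrow> ('e, 's) config \<Rightarrow> ('e, 's) config pmf \<Rightarrow> bool"
  for Val :: "'e set" and step :: "('e, 's) step_rel" where
  val: "v \<in> Val \<Longrightarrow> std_bigstep Val step (v, \<sigma>) (return_pmf (v, \<sigma>))"
| det: "step c c1 c2 1 \<Longrightarrow> std_bigstep Val step c1 \<mu> \<Longrightarrow> std_bigstep Val step c \<mu>"
| prob: "step c c1 c2 p \<Longrightarrow> std_bigstep Val step c1 \<mu>1 \<Longrightarrow> std_bigstep Val step c2 \<mu>2
    \<Longrightarrow> std_bigstep Val step c (mix_pmf p \<mu>1 \<mu>2)"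


section \<open>Probability spaces over randomness\<close>

text \<open>
  The sample space is \<open>'r \<Rightarrow> bool\<close>, with \<open>'r\<close> the randomness identifiers. For a set \<open>R\<close> of
  identifiers, the functions \<open>R \<rightarrow> bool\<close> are represented by the extensional functions
  \<open>R \<rightarrow>\<^sub>E UNIV\<close>.

  All spaces over the sample space are complete. Hence an operation whose textbook value need
  not be complete (product with a trivial space, conditioning, the space of one biased bit) is
  followed by \<^const>\<open>completion\<close>. This matters: weighted sums intersect the sigma-algebras of
  the conditioned spaces, so those have to contain all subsets of the null event outside of the
  conditioning event. Independent products and weighted sums of the complete spaces at hand are
  already complete.
\<close>

definition triv :: "'r set \<Rightarrow> ('r \<Rightarrow> bool) measure" where
  "triv S = measure_of (S \<rightarrow>\<^sub>E UNIV) {} (\<lambda>E. if E = {} then 0 else 1)"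

definition psi0 :: "('r \<Rightarrow> bool) measure" where
  "psi0 = triv UNIV"

text \<open>
  \<open>prob_space_on R \<psi>\<close>: \<open>\<psi>\<close> is a probability space on \<open>R \<rightarrow> bool\<close>. \<open>tensor_triv R \<psi>\<close> is the
  product of \<open>\<psi>\<close> with the trivial space on \<open>(UNIV - R) \<rightarrow> bool\<close>, transported along the
  bijection \<open>merge R (- R)\<close> onto the full sample space.
\<close>

definition prob_space_on :: "'r set \<Rightarrow> ('r \<Rightarrow> bool) measure \<Rightarrow> bool" where
  "prob_space_on R \<psi> \<longleftrightarrow> prob_space \<psi> \<and> space \<psi> = (R \<rightarrow>\<^sub>E UNIV)"

definition tensor_triv :: "'r set \<Rightarrow> ('r \<Rightarrow> bool) measure \<Rightarrow> ('r \<Rightarrow> bool) measure" where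
  "tensor_triv R \<psi> = completion (embed_measure (\<psi> \<Otimes>\<^sub>M triv (- R)) (merge R (- R)))"

definition pspace :: "('r \<Rightarrow> bool) measure \<Rightarrow> bool" where
  "pspace \<psi> \<longleftrightarrow> prob_space_on UNIV \<psi> \<and> complete_measure \<psi> \<and>
     (\<exists>R \<psi>R. finite R \<and> prob_space_on R \<psi>R \<and> \<psi> = tensor_triv R \<psi>R)"

text \<open>
  ``Subevent'' means proper subevent. In a complete space this excludes atoms containing a
  nonempty null event, so distinct atoms are disjoint and, for the spaces in \<^const>\<open>pspace\<close>,
  their probabilities add up to 1.
\<close>

definition atoms :: "'a measure \<Rightarrow> 'a set set" where
  "atoms \<psi> = {X \<in> sets \<psi>. emeasure \<psi> X \<noteq> 0 \<and> (\<forall>Z \<in> sets \<psi>. Z \<subset> X \<longrightarrow> emeasure \<psi> Z = 0)}"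

definition cond_space :: "'a measure \<Rightarrow> 'a set \<Rightarrow> 'a measure" where
  "cond_space \<psi> Y = completion (uniform_measure \<psi> Y)"

text \<open>
  The independent product is a partial operation; \<open>is_indep_prod \<psi>1 \<psi>2 \<psi>\<close> says that it is
  defined on \<open>\<psi>1\<close>, \<open>\<psi>2\<close> and equal to \<open>\<psi>\<close>, which is then unique because the events
  \<open>E1 \<inter> E2\<close> form an intersection-stable generator.
\<close>

definition is_indep_prod ::
    "('r \<Rightarrow> bool) measure \<Rightarrow> ('r \<Rightarrow> bool) measure \<Rightarrow> ('r \<Rightarrow> bool) measure \<Rightarrow> bool" where
  "is_indep_prod \<psi>1 \<psi>2 \<psi> \<longleftrightarrow>
     prob_space \<psi> \<and>
     sets \<psi> = sigma_sets UNIV (sets \<psi>1 \<union> sets \<psi>2) \<and>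
     (\<forall>E1 \<in> sets \<psi>1. \<forall>E2 \<in> sets \<psi>2.
        emeasure \<psi> (E1 \<inter> E2) = emeasure \<psi>1 E1 * emeasure \<psi>2 E2)"

definition support :: "'a measure \<Rightarrow> 'a set" where
  "support \<psi> = space \<psi> - \<Union> (null_sets \<psi>)"

definition wsum_defined :: "'a pmf \<Rightarrow> ('a \<Rightarrow> ('r \<Rightarrow> bool) measure) \<Rightarrow> bool" where
  "wsum_defined \<nu> \<kappa> \<longleftrightarrow>
     finite (set_pmf \<nu>) \<and> disjoint_family_on (\<lambda>a. support (\<kappa> a)) (set_pmf \<nu>)"

definition wsum :: "'a pmf \<Rightarrow> ('a \<Rightarrow> ('r \<Rightarrow> bool) measure) \<Rightarrow> ('r \<Rightarrow> bool) measure" where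
  "wsum \<nu> \<kappa> = measure_of UNIV (\<Inter>a \<in> set_pmf \<nu>. sets (\<kappa> a))
     (\<lambda>E. \<Sum>a \<in> set_pmf \<nu>. ennreal (pmf \<nu> a) * emeasure (\<kappa> a) E)"

text \<open>
  The events of the generated sigma-algebra are the preimages of sets of booleans under
  \<open>\<lambda>\<rho>. \<rho> r\<close>, and the image of such an event is the set of booleans it comes from.
\<close>

definition ber :: "'r \<Rightarrow> real \<Rightarrow> ('r \<Rightarrow> bool) measure" where
  "ber r p = completion (measure_of UNIV {{\<rho>. \<rho> r = True}}
     (\<lambda>E. emeasure (measure_pmf (bernoulli_pmf p)) ((\<lambda>\<rho>. \<rho> r) ` E)))"


section \<open>The collecting semantics\<close>

text \<open>
  In \<open>cstep\<close>, \<open>\<nu>\<close> is the distribution of the atoms of \<open>\<psi>1\<close>, and \<open>\<kappa> Y\<close> is the independent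
  product of \<open>\<psi>1\<close> conditioned on \<open>Y\<close> with a biased bit (if \<open>Y = X\<close>) or the trivial space.
\<close>

definition cstep ::
    "('e, 's) step_rel \<Rightarrow>
     ('r \<Rightarrow> bool) measure \<times> (('r \<Rightarrow> bool) \<Rightarrow> ('e, 's) config) \<Rightarrow>
     ('r \<Rightarrow> bool) measure \<times> (('r \<Rightarrow> bool) \<Rightarrow> ('e, 's) config) \<Rightarrow> bool" where
  "cstep step = (\<lambda>(\<psi>1, C1) (\<psi>2, C2).
     pspace \<psi>1 \<and> pspace \<psi>2 \<and>
     (\<exists>X r e1 \<sigma>1 e2 \<sigma>2 p.
        X \<in> atoms \<psi>1 \<and>
        (\<exists>\<psi>1'. prob_space_on (- {r}) \<psi>1' \<and> \<psi>1 = tensor_triv (- {r}) \<psi>1') \<and>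
        (\<exists>\<nu> \<kappa>.
           (\<forall>Y. pmf \<nu> Y = (if Y \<in> atoms \<psi>1 then measure \<psi>1 Y else 0)) \<and>
           (\<forall>Y \<in> atoms \<psi>1.
              is_indep_prod (cond_space \<psi>1 Y) (if X = Y then ber r p else psi0) (\<kappa> Y)) \<and>
           wsum_defined \<nu> \<kappa> \<and>
           \<psi>2 = wsum \<nu> \<kappa>) \<and>
        (\<forall>\<rho> \<in> X. step (C1 \<rho>) (e1, \<sigma>1) (e2, \<sigma>2) p) \<and>
        (\<forall>\<rho> \<in> X. C2 (\<rho>(r := True)) = (e1, \<sigma>1) \<and>
           (p \<noteq> 1 \<longrightarrow> C2 (\<rho>(r := False)) = (e2, \<sigma>2))) \<and>
        (\<forall>Y \<in> atoms \<psi>1. Y \<noteq> X \<longrightarrow> (\<forall>\<rho> \<in> Y. C1 \<rho> = C2 \<rho>))))"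

text \<open>
  In rule \<open>val\<close>, \<open>emeasure \<psi> E = 1\<close> includes that \<open>E\<close> is an event, since non-measurable sets
  have \<^const>\<open>emeasure\<close> 0.
\<close>

inductive bigstep ::
    "'e set \<Rightarrow> ('e, 's) step_rel \<Rightarrow>
     ('r \<Rightarrow> bool) measure \<times> (('r \<Rightarrow> bool) \<Rightarrow> ('e, 's) config) \<Rightarrow>
     ('r \<Rightarrow> bool) measure \<times> (('r \<Rightarrow> bool) \<Rightarrow> ('e, 's) config) \<Rightarrow> bool"
  for Val :: "'e set" and step :: "('e, 's) step_rel" where
  val: "pspace \<psi> \<Longrightarrow> emeasure \<psi> {\<rho>. C1 \<rho> = C2 \<rho>} = 1 \<Longrightarrow> (\<forall>\<rho>. C2 \<rho> \<in> Val \<times> UNIV)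
    \<Longrightarrow> bigstep Val step (\<psi>, C1) (\<psi>, C2)"
| step: "cstep step (\<psi>1, C1) (\<psi>2, C2) \<Longrightarrow> bigstep Val step (\<psi>2, C2) (\<psi>3, C3)
    \<Longrightarrow> bigstep Val step (\<psi>1, C1) (\<psi>3, C3)"

end

theory Submission
  imports Defs
begin

text \<open>
  Every space that arises carries only finite information: its events are the sets that, up to the
  null complement, are unions of finitely many disjoint nonempty blocks. So it is determined by the
  probability mass function of its blocks, which are exactly its atoms. Under this encoding all
  operations on spaces become operations on mass functions: conditioning on an atom yields a point
  mass, the independent product intersects blocks, and the weighted sum is the monadic bind. One
  collecting step replaces a single atom by its two halves according to the value of a fresh bit,
  hence associativity of bind turns it into one probabilistic rule of the standard semantics.

  If a run of the collecting semantics starts in a configuration variable that is constant on the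
  atoms, then induction over the run assigns to each atom a standard result such that their mixture
  is the final distribution. Conversely, given standard derivations for all atoms, any atom that has
  not reached a value can be split on a fresh bit, which lowers the total size of the derivations.
\<close>

text \<open>The blocks of a space need not cover the sample space: after a step of probability 1 the
  \<open>False\<close> half of the split atom is a null set, and nothing constrains the
  configurations there. Hence constancy is only ever required on blocks, and every set that cuts no
  block is an event. The completions in the definitions keep this description stable. Conditioning
  turns all other blocks into null sets, and the intersection of sigma-algebras in a weighted sum
  retains the blocks of one summand because they lie in the null part of the others. Atomicity of a
  space in \<open>pspace\<close> has to be derived: finitely many identifiers admit finitely many
  events before completion, and completion changes an event by a null set only. Freshness of
  \<open>r\<close> is the same product form with \<open>- {r}\<close> in place of a finite set, so
  the key facts about \<open>tensor_triv\<close> allow infinite \<open>R\<close>.\<close>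

section \<open>Spaces generated by disjoint blocks\<close>

text \<open>
  All subsets of the complement of the blocks are events, so the space is complete. The measure is
  countably additive only if no block is empty.
\<close>

definition block_pmf :: "'a set pmf \<Rightarrow> bool" where
  "block_pmf P \<longleftrightarrow> {} \<notin> set_pmf P \<and> disjoint (set_pmf P)"

definition block_sets :: "'a set pmf \<Rightarrow> 'a set set" where
  "block_sets P = {E. \<forall>A\<in>set_pmf P. A \<subseteq> E \<or> A \<inter> E = {}}"

definition block_space :: "'a set pmf \<Rightarrow> 'a measure" where
  "block_space P = measure_of UNIV (block_sets P) (\<lambda>E. emeasure P {A. A \<subseteq> E})"

lemma block_pmf_disjoint:
  "block_pmf P \<Longrightarrow> A \<in> set_pmf P \<Longrightarrow> B \<in> set_pmf P \<Longrightarrow> A \<noteq> B \<Longrightarrow> A \<inter> B = {}"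
  by (auto simp: block_pmf_def disjoint_def)

lemma block_pmf_nonempty: "block_pmf P \<Longrightarrow> A \<in> set_pmf P \<Longrightarrow> A \<noteq> {}"
  by (auto simp: block_pmf_def)

lemma block_pmf_return: "A \<noteq> {} \<Longrightarrow> block_pmf (return_pmf A)"
  by (auto simp: block_pmf_def)

lemma sigma_algebra_block_sets: "sigma_algebra UNIV (block_sets P)"
  unfolding sigma_algebra_iff2
proof (intro conjI ballI allI impI)
  fix F :: "nat \<Rightarrow> 'a set" assume F: "range F \<subseteq> block_sets P"
  show "(\<Union>i. F i) \<in> block_sets P"
    unfolding block_sets_def
  proof (intro CollectI ballI)
    fix A assume "A \<in> set_pmf P"
    then have "\<forall>i. A \<subseteq> F i \<or> A \<inter> F i = {}"
      using F unfolding block_sets_def by blast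
    then show "A \<subseteq> (\<Union>i. F i) \<or> A \<inter> (\<Union>i. F i) = {}" by blast
  qed
qed (auto simp: block_sets_def)

lemma sets_block_space [simp]: "sets (block_space P) = block_sets P"
  unfolding block_space_def by (rule sigma_algebra.sets_measure_of_eq[OF sigma_algebra_block_sets])

lemma space_block_space [simp]: "space (block_space P) = UNIV"
  unfolding block_space_def by (rule sigma_algebra.space_measure_of_eq[OF sigma_algebra_block_sets])

text \<open>A nonempty block inside a disjoint union of events meets exactly one of them and, as
  events never cut a block, lies inside it. So countable additivity is inherited from
  \<open>P\<close>.\<close>

lemma emeasure_block_space:
  assumes "block_pmf P" "E \<in> block_sets P"
  shows "emeasure (block_space P) E = emeasure P {A. A \<subseteq> E}"
  unfolding block_space_def
proof (rule emeasure_measure_of_sigma[OF sigma_algebra_block_sets _ _ assms(2)])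
  have ne: "A \<noteq> {}" if "A \<in> set_pmf P" for A
    using that assms(1) by (rule block_pmf_nonempty[rotated])
  \<comment> \<open>Passing to the support discards the empty set, which would otherwise be counted
    in every \<open>F i\<close>.\<close>
  have restr: "emeasure P {A. A \<subseteq> E} = emeasure P {A \<in> set_pmf P. A \<subseteq> E}" for E :: "'a set"
    by (rule emeasure_eq_AE) (auto simp: AE_measure_pmf_iff)
  show "positive (block_sets P) (\<lambda>E. emeasure P {A. A \<subseteq> E})"
    using ne by (auto simp: positive_def emeasure_pmf_single pmf_eq_0_set_pmf)
  show "countably_additive (block_sets P) (\<lambda>E. emeasure P {A. A \<subseteq> E})"
  proof (rule countably_additiveI)
    fix F :: "nat \<Rightarrow> 'a set"
    assume F: "range F \<subseteq> block_sets P" "disjoint_family F"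
    have "{A \<in> set_pmf P. A \<subseteq> (\<Union>i. F i)} = (\<Union>i. {A \<in> set_pmf P. A \<subseteq> F i})"
    proof (intro equalityI subsetI)
      fix A assume "A \<in> {A \<in> set_pmf P. A \<subseteq> (\<Union>i. F i)}"
      then have A: "A \<in> set_pmf P" "A \<subseteq> (\<Union>i. F i)" by auto
      with ne[OF A(1)] obtain i where "A \<inter> F i \<noteq> {}" by blast
      with A F(1) show "A \<in> (\<Union>i. {A \<in> set_pmf P. A \<subseteq> F i})"
        unfolding block_sets_def by blast
    qed auto
    moreover have "disjoint_family (\<lambda>i. {A \<in> set_pmf P. A \<subseteq> F i})"
      using F(2) ne unfolding disjoint_family_on_def by blast
    ultimately show "(\<Sum>i. emeasure P {A. A \<subseteq> F i}) = emeasure P {A. A \<subseteq> (\<Union>i. F i)}"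
      unfolding restr by (simp add: suminf_emeasure)
  qed
qed

lemma block_mem_sets:
  assumes "block_pmf P" "A \<in> set_pmf P"
  shows "A \<in> block_sets P"
  unfolding block_sets_def
proof (intro CollectI ballI)
  show "B \<subseteq> A \<or> B \<inter> A = {}" if "B \<in> set_pmf P" for B
    using block_pmf_disjoint[OF assms(1) that assms(2)] by (cases "B = A") auto
qed

lemma emeasure_block:
  assumes "block_pmf P" "A \<in> set_pmf P"
  shows "emeasure (block_space P) A = pmf P A"
proof -
  have "B \<subseteq> A \<longleftrightarrow> B = A" if "B \<in> set_pmf P" for B
    using block_pmf_disjoint[OF assms(1) that assms(2)] block_pmf_nonempty[OF assms(1) that] by blast
  then have "emeasure P {B. B \<subseteq> A} = emeasure P {A}"
    by (intro emeasure_eq_AE) (auto simp: AE_measure_pmf_iff)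
  then show ?thesis
    using emeasure_block_space[OF assms(1) block_mem_sets[OF assms]]
    by (simp add: emeasure_pmf_single)
qed

lemma emeasure_block_space_eq_0_iff:
  assumes "block_pmf P" "E \<in> block_sets P"
  shows "emeasure (block_space P) E = 0 \<longleftrightarrow> (\<forall>A\<in>set_pmf P. A \<inter> E = {})"
proof -
  have *: "\<not> A \<subseteq> E \<longleftrightarrow> A \<inter> E = {}" if "A \<in> set_pmf P" for A
    using that assms(2) block_pmf_nonempty[OF assms(1) that] by (auto simp: block_sets_def)
  have "emeasure (block_space P) E = 0 \<longleftrightarrow> measure P {A. A \<subseteq> E} = 0"
    by (simp add: emeasure_block_space[OF assms] measure_pmf.emeasure_eq_measure)
  also have "\<dots> \<longleftrightarrow> (\<forall>A\<in>set_pmf P. \<not> A \<subseteq> E)"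
    by (auto simp: measure_pmf_zero_iff)
  finally show ?thesis
    using * by simp
qed

lemma emeasure_block_space_eq_1_iff:
  assumes "block_pmf P" "E \<in> block_sets P"
  shows "emeasure (block_space P) E = 1 \<longleftrightarrow> (\<forall>A\<in>set_pmf P. A \<subseteq> E)"
  using assms measure_pmf.prob_eq_1[of "{A. A \<subseteq> E}" P]
  by (simp add: emeasure_block_space measure_pmf.emeasure_eq_measure AE_measure_pmf_iff)

lemma prob_space_block_space: "block_pmf P \<Longrightarrow> prob_space (block_space P)"
  by (rule prob_spaceI) (simp add: emeasure_block_space block_sets_def emeasure_pmf)

lemma complete_measure_block_space:
  assumes "block_pmf P"
  shows "complete_measure (block_space P)"
proof
  fix N E assume "N \<subseteq> E" "E \<in> null_sets (block_space P)"
  then have "\<forall>A\<in>set_pmf P. A \<inter> E = {}"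
    using emeasure_block_space_eq_0_iff[OF assms, of E] by (simp add: null_sets_def)
  with \<open>N \<subseteq> E\<close> show "N \<in> sets (block_space P)"
    by (auto simp: block_sets_def)
qed

text \<open>An event of positive probability contains a block, so a minimal one equals that block.
  Conversely, an event properly inside a block cannot contain it, hence is disjoint from it and from
  all other blocks, hence null.\<close>

lemma atoms_block_space:
  assumes "block_pmf P"
  shows "atoms (block_space P) = set_pmf P"
proof (intro equalityI subsetI)
  fix X assume X: "X \<in> atoms (block_space P)"
  then have "X \<in> block_sets P" "emeasure (block_space P) X \<noteq> 0"
    by (auto simp: atoms_def)
  then obtain A where A: "A \<in> set_pmf P" "A \<inter> X \<noteq> {}"
    using emeasure_block_space_eq_0_iff[OF assms] by blast
  with X have "A \<subseteq> X" by (auto simp: atoms_def block_sets_def)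
  moreover have "emeasure (block_space P) A \<noteq> 0"
    using A emeasure_block[OF assms] by (simp add: set_pmf_iff)
  ultimately show "X \<in> set_pmf P"
    using X A block_mem_sets[OF assms A(1)] by (auto simp: atoms_def)
next
  fix A assume A: "A \<in> set_pmf P"
  have "emeasure (block_space P) Z = 0" if Z: "Z \<in> block_sets P" "Z \<subset> A" for Z
  proof -
    have "B \<inter> Z = {}" if "B \<in> set_pmf P" for B
      using that Z A block_pmf_disjoint[OF assms that A]
      by (cases "B = A") (auto simp: block_sets_def)
    then show ?thesis
      using emeasure_block_space_eq_0_iff[OF assms Z(1)] by blast
  qed
  with A show "A \<in> atoms (block_space P)"
    using emeasure_block[OF assms A] block_mem_sets[OF assms A]
    by (auto simp: atoms_def set_pmf_iff)
qed

text \<open>\<open>M\<close> may have fewer events than the block space, so values can be compared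
  before completing. The finitely many block masses sum to 1, which makes everything off the blocks
  null in \<open>M\<close>; an event then differs from the union of its blocks by a null
  set.\<close>

lemma emeasure_eq_block_space:
  assumes P: "block_pmf P" "finite (set_pmf P)" and M: "prob_space M" "space M = UNIV"
    and A: "\<And>A. A \<in> set_pmf P \<Longrightarrow> A \<in> sets M \<and> emeasure M A = pmf P A"
    and E: "E \<in> sets M" "E \<in> block_sets P"
  shows "emeasure M E = emeasure (block_space P) E"
proof -
  interpret prob_space M by fact
  have sum: "measure M (\<Union>S) = measure P S" if "S \<subseteq> set_pmf P" for S
  proof -
    have "finite S" using that P(2) by (rule finite_subset)
    moreover have "disjoint_family_on (\<lambda>A. A) S"
      using that block_pmf_disjoint[OF P(1)] by (auto simp: disjoint_family_on_def)
    moreover have "measure M B = pmf P B" if "B \<in> S" for B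
      using that \<open>S \<subseteq> _\<close> A[of B] by (auto simp: measure_def)
    ultimately show ?thesis
      using that A finite_measure_finite_Union[of S "\<lambda>A. A"]
      by (auto simp: measure_measure_pmf_finite)
  qed
  define S where "S = {A \<in> set_pmf P. A \<subseteq> E}"
  have S: "\<Union>S \<in> sets M" "\<Union>(set_pmf P) \<in> sets M"
    using A P(2) by (auto simp: S_def intro!: sets.finite_Union)
  have "measure M (- \<Union>(set_pmf P)) = 0"
    using prob_compl[OF S(2)] sum[of "set_pmf P"] M(2) measure_Int_set_pmf[of P UNIV]
      measure_pmf.prob_space[of P]
    by (simp add: Compl_eq_Diff_UNIV)
  moreover have "E - \<Union>S \<subseteq> - \<Union>(set_pmf P)"
    using E(2) by (auto simp: S_def block_sets_def)
  ultimately have "measure M (E - \<Union>S) = 0"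
    using finite_measure_mono[of "E - \<Union>S" "- \<Union>(set_pmf P)"] S E(1) M(2)
    by (metis (no_types, lifting) Compl_eq_Diff_UNIV measure_nonneg order_antisym sets.Diff sets.top)
  moreover have "E = \<Union>S \<union> (E - \<Union>S)" by (auto simp: S_def)
  moreover have "measure M (\<Union>S \<union> (E - \<Union>S)) = measure M (\<Union>S) + measure M (E - \<Union>S)"
    using S E by (intro finite_measure_Union) auto
  ultimately have "measure M E = measure P S"
    using sum[of S] by (simp add: S_def)
  also have "\<dots> = measure P {A. A \<subseteq> E}"
    by (subst (2) measure_Int_set_pmf[symmetric]) (auto simp: S_def intro: arg_cong[where f = "measure P"])
  finally show ?thesis
    using P E by (simp add: emeasure_block_space emeasure_eq_measure measure_pmf.emeasure_eq_measure)
qed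

lemma block_space_eqI:
  assumes P: "block_pmf P" "finite (set_pmf P)" and M: "prob_space M"
    and A: "\<And>A. A \<in> set_pmf P \<Longrightarrow> emeasure M A = pmf P A"
    and sets: "sets M = block_sets P"
  shows "M = block_space P"
proof (rule measure_eqI)
  have "space M = UNIV"
    using sets sets_eq_imp_space_eq[of M "block_space P"] by simp
  then show "emeasure M E = emeasure (block_space P) E" if "E \<in> sets M" for E
    using that by (intro emeasure_eq_block_space P M) (auto simp: A sets block_mem_sets P(1))
qed (simp add: sets)

text \<open>The common tool for conditioning, the biased bit and the product with a trivial space.
  The complement of the blocks is null in \<open>M\<close>, so completing adds all of its subsets;
  finite unions of blocks supply the rest of each event.\<close>

lemma completion_eq_block_space:
  assumes P: "block_pmf P" "finite (set_pmf P)" and M: "prob_space M" "space M = UNIV"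
    and A: "\<And>A. A \<in> set_pmf P \<Longrightarrow> A \<in> sets M \<and> emeasure M A = pmf P A"
    and sets: "sets M \<subseteq> block_sets P"
  shows "completion M = block_space P"
proof -
  have null: "N \<in> null_sets M \<longleftrightarrow> N \<in> sets M \<and> (\<forall>A\<in>set_pmf P. A \<inter> N = {})" for N
  proof (cases "N \<in> sets M")
    case True
    then have "N \<in> block_sets P" using sets by blast
    with True show ?thesis
      using emeasure_eq_block_space[OF P M A, of N] emeasure_block_space_eq_0_iff[OF P(1), of N]
      by (simp add: null_sets_def)
  qed auto
  have rest: "- \<Union>(set_pmf P) \<in> null_sets M"
  proof -
    have "\<Union>(set_pmf P) \<in> sets M"
      using A P(2) by (auto intro!: sets.finite_Union)
    then have "- \<Union>(set_pmf P) \<in> sets M"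
      using M(2) by (metis Compl_eq_Diff_UNIV sets.Diff sets.top)
    then show ?thesis unfolding null by auto
  qed
  show ?thesis
  proof (rule block_space_eqI[OF P])
    show "prob_space (completion M)"
      using M(1) by (rule prob_space.prob_space_completion)
    show "emeasure (completion M) A = pmf P A" if "A \<in> set_pmf P" for A
      using A[OF that] by simp
    show "sets (completion M) = block_sets P"
    proof (intro equalityI subsetI)
      fix E assume "E \<in> sets (completion M)"
      then obtain S N N' where N: "E = S \<union> N" "N \<subseteq> N'" "N' \<in> null_sets M" "S \<in> sets M"
        by (rule sets_completionE)
      have "S \<in> block_sets P" using N sets by blast
      moreover have "A \<inter> N = {}" if "A \<in> set_pmf P" for A
        using that N(2,3) by (auto simp: null)
      ultimately show "E \<in> block_sets P"
        by (fastforce simp: block_sets_def N(1))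
    next
      fix E assume E: "E \<in> block_sets P"
      have "\<Union>{A \<in> set_pmf P. A \<subseteq> E} \<in> sets M"
        using A P(2) by (auto intro!: sets.finite_Union)
      moreover have "E = \<Union>{A \<in> set_pmf P. A \<subseteq> E} \<union> (E - \<Union>(set_pmf P))"
        using E unfolding block_sets_def by blast
      ultimately show "E \<in> sets (completion M)"
        using rest by (intro sets_completionI[of _ "\<Union>{A \<in> set_pmf P. A \<subseteq> E}"]) auto
    qed
  qed
qed

text \<open>The single block is the whole sample space, so the null part is empty and
  \<open>psi0\<close> is complete as it stands.\<close>

lemma psi0_eq_block_space: "psi0 = block_space (return_pmf UNIV)"
proof -
  have sets: "sigma_sets UNIV {} = {{}, UNIV :: ('r \<Rightarrow> bool) set}"
    by (rule sigma_sets_empty_eq)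
  have "psi0 = (measure_of UNIV {} (\<lambda>E. if E = {} then 0 else 1) :: ('r \<Rightarrow> bool) measure)"
    by (simp add: psi0_def triv_def)
  also have "\<dots> = measure_of UNIV {} (\<lambda>E. emeasure (return_pmf UNIV) {A. A \<subseteq> E})"
    by (rule measure_of_eq) (auto simp: sets)
  also have "\<dots> = measure_of UNIV (sigma_sets UNIV {}) (\<lambda>E. emeasure (return_pmf UNIV) {A. A \<subseteq> E})"
    by (simp add: measure_of_def sigma_sets_sigma_sets_eq)
  also note sets
  also have "{{}, UNIV :: ('r \<Rightarrow> bool) set} = block_sets (return_pmf UNIV)"
    by (auto simp: block_sets_def)
  finally show ?thesis by (simp add: block_space_def)
qed

text \<open>Conditioning makes the other blocks null, and completion then admits every subset of
  them as an event. Without completion those blocks would still restrict the events.\<close>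

lemma cond_space_block_space:
  assumes P: "block_pmf P" and Y: "Y \<in> set_pmf P"
  shows "cond_space (block_space P) Y = block_space (return_pmf Y)"
  unfolding cond_space_def
proof (rule completion_eq_block_space)
  have ms: "Y \<in> sets (block_space P)" using block_mem_sets[OF P Y] by simp
  have em: "emeasure (block_space P) Y = pmf P Y" by (rule emeasure_block[OF P Y])
  have pos: "emeasure (block_space P) Y \<noteq> 0" using Y em by (simp add: set_pmf_iff)
  show "prob_space (uniform_measure (block_space P) Y)"
    using pos em by (intro prob_space_uniform_measure) auto
  show "A \<in> sets (uniform_measure (block_space P) Y) \<and>
      emeasure (uniform_measure (block_space P) Y) A = pmf (return_pmf Y) A"
    if "A \<in> set_pmf (return_pmf Y)" for A
    using that ms emeasure_uniform_measure_1[OF pos] em by simp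
  show "sets (uniform_measure (block_space P) Y) \<subseteq> block_sets (return_pmf Y)"
    using Y by (auto simp: block_sets_def)
  show "block_pmf (return_pmf Y)"
    using block_pmf_nonempty[OF P Y] by (rule block_pmf_return)
qed simp_all

section \<open>Products, weighted sums and random bits\<close>

definition inter_pmf :: "'a set pmf \<Rightarrow> 'a set pmf \<Rightarrow> 'a set pmf" where
  "inter_pmf P Q = map_pmf (\<lambda>(A, B). A \<inter> B) (pair_pmf P Q)"

lemma set_inter_pmf: "set_pmf (inter_pmf P Q) = {A \<inter> B |A B. A \<in> set_pmf P \<and> B \<in> set_pmf Q}"
  by (auto simp: inter_pmf_def image_iff)

lemma block_pmf_inter:
  assumes "block_pmf P" "block_pmf Q"
    and "\<And>A B. A \<in> set_pmf P \<Longrightarrow> B \<in> set_pmf Q \<Longrightarrow> A \<inter> B \<noteq> {}"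
  shows "block_pmf (inter_pmf P Q)"
  unfolding block_pmf_def disjoint_def
proof (intro conjI ballI impI)
  show "{} \<notin> set_pmf (inter_pmf P Q)"
    using assms(3) by (auto simp: set_inter_pmf)
next
  fix X Y assume "X \<in> set_pmf (inter_pmf P Q)" "Y \<in> set_pmf (inter_pmf P Q)" "X \<noteq> Y"
  then obtain A B A' B' where "X = A \<inter> B" "Y = A' \<inter> B'" "A \<noteq> A' \<or> B \<noteq> B'"
    "A \<in> set_pmf P" "A' \<in> set_pmf P" "B \<in> set_pmf Q" "B' \<in> set_pmf Q"
    by (auto simp: set_inter_pmf)
  moreover have "A \<noteq> A' \<Longrightarrow> A \<inter> A' = {}" "B \<noteq> B' \<Longrightarrow> B \<inter> B' = {}"
    using calculation block_pmf_disjoint assms(1,2) by metis+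
  ultimately show "X \<inter> Y = {}" by auto
qed

text \<open>A point of an event lies in some intersection of two blocks or off all blocks of one
  factor. The first kind yields a finite union of generated sets; the second kind is a subset of the
  null part of one factor and therefore already an event of that factor.\<close>

lemma sigma_sets_block_sets_Un:
  assumes P: "block_pmf P" "finite (set_pmf P)" and Q: "block_pmf Q" "finite (set_pmf Q)"
  shows "sigma_sets UNIV (block_sets P \<union> block_sets Q) = block_sets (inter_pmf P Q)"
proof (rule antisym)
  have sub: "block_sets P \<subseteq> block_sets (inter_pmf P Q)" "block_sets Q \<subseteq> block_sets (inter_pmf P Q)"
    by (simp add: block_sets_def set_inter_pmf, blast)+
  then show "sigma_sets UNIV (block_sets P \<union> block_sets Q) \<subseteq> block_sets (inter_pmf P Q)"
    by (intro sigma_algebra.sigma_sets_subset[OF sigma_algebra_block_sets]) simp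
  interpret S: sigma_algebra UNIV "sigma_sets UNIV (block_sets P \<union> block_sets Q)"
    by (rule sigma_algebra_sigma_sets) simp
  show "block_sets (inter_pmf P Q) \<subseteq> sigma_sets UNIV (block_sets P \<union> block_sets Q)"
  proof
    fix E assume E: "E \<in> block_sets (inter_pmf P Q)"
    define S where "S = {X \<in> set_pmf (inter_pmf P Q). X \<subseteq> E}"
    have "S \<subseteq> sigma_sets UNIV (block_sets P \<union> block_sets Q)"
    proof
      fix X assume "X \<in> S"
      then obtain A B where "X = A \<inter> B" "A \<in> set_pmf P" "B \<in> set_pmf Q"
        by (auto simp: S_def set_inter_pmf)
      then show "X \<in> sigma_sets UNIV (block_sets P \<union> block_sets Q)"
        using block_mem_sets[OF P(1)] block_mem_sets[OF Q(1)] by (auto intro!: S.Int)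
    qed
    moreover have "finite S"
      using P Q by (auto simp: S_def inter_pmf_def)
    ultimately have "\<Union>S \<in> sigma_sets UNIV (block_sets P \<union> block_sets Q)"
      by (intro S.finite_Union)
    moreover have "E - \<Union>(set_pmf P) \<in> block_sets P" "E - \<Union>(set_pmf Q) \<in> block_sets Q"
      by (auto simp: block_sets_def)
    moreover have "E = \<Union>S \<union> ((E - \<Union>(set_pmf P)) \<union> (E - \<Union>(set_pmf Q)))"
    proof (intro equalityI subsetI)
      fix x assume x: "x \<in> E"
      show "x \<in> \<Union>S \<union> ((E - \<Union>(set_pmf P)) \<union> (E - \<Union>(set_pmf Q)))"
      proof (cases "x \<in> \<Union>(set_pmf P) \<and> x \<in> \<Union>(set_pmf Q)")
        case True
        then obtain A B where AB: "A \<in> set_pmf P" "B \<in> set_pmf Q" "x \<in> A \<inter> B" by auto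
        then have "A \<inter> B \<in> set_pmf (inter_pmf P Q)" by (auto simp: set_inter_pmf)
        moreover from this have "A \<inter> B \<subseteq> E \<or> (A \<inter> B) \<inter> E = {}"
          using E by (simp only: block_sets_def mem_Collect_eq)
        moreover have "\<not> (A \<inter> B) \<inter> E = {}"
          using x AB(3) by blast
        ultimately have "A \<inter> B \<in> S"
          unfolding S_def by blast
        then show ?thesis using AB(3) by blast
      next
        case False
        then show ?thesis using x by blast
      qed
    next
      fix x assume "x \<in> \<Union>S \<union> ((E - \<Union>(set_pmf P)) \<union> (E - \<Union>(set_pmf Q)))"
      then show "x \<in> E" unfolding S_def by blast
    qed
    ultimately show "E \<in> sigma_sets UNIV (block_sets P \<union> block_sets Q)"
      by (metis (no_types) S.Un UnI1 UnI2 sigma_sets.Basic)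
  qed
qed

text \<open>Because any two blocks meet, \<open>A \<inter> B\<close> fits into
  \<open>E1 \<inter> E2\<close> only if each block fits into its own event. The condition on the
  intersection is thus a rectangle condition on independently drawn blocks.\<close>

lemma emeasure_inter_pmf:
  assumes P: "block_pmf P" and Q: "block_pmf Q"
    and ne: "\<And>A B. A \<in> set_pmf P \<Longrightarrow> B \<in> set_pmf Q \<Longrightarrow> A \<inter> B \<noteq> {}"
    and E: "E1 \<in> block_sets P" "E2 \<in> block_sets Q"
  shows "emeasure (inter_pmf P Q) {X. X \<subseteq> E1 \<inter> E2} =
    emeasure (block_space P) E1 * emeasure (block_space Q) E2"
proof -
  have "A \<inter> B \<subseteq> E1 \<inter> E2 \<longleftrightarrow> A \<subseteq> E1 \<and> B \<subseteq> E2" if "A \<in> set_pmf P" "B \<in> set_pmf Q" for A B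
  proof -
    have "A \<subseteq> E1 \<or> A \<inter> E1 = {}" "B \<subseteq> E2 \<or> B \<inter> E2 = {}"
      using that E by (auto simp: block_sets_def)
    with ne[OF that] show ?thesis by blast
  qed
  then have "emeasure (inter_pmf P Q) {X. X \<subseteq> E1 \<inter> E2} =
      emeasure (pair_pmf P Q) ({A. A \<subseteq> E1} \<times> {B. B \<subseteq> E2})"
    unfolding inter_pmf_def emeasure_map_pmf
    by (intro emeasure_eq_AE) (auto simp: AE_measure_pmf_iff)
  also have "\<dots> = emeasure P {A. A \<subseteq> E1} * emeasure Q {B. B \<subseteq> E2}"
    by (simp add: nn_integral_pair_pmf' indicator_times nn_integral_cmult nn_integral_multc
        flip: nn_integral_indicator)
  finally show ?thesis
    using E by (simp add: emeasure_block_space P Q)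
qed

text \<open>For uniqueness, each block of the product is an intersection of two events of the
  factors, so the defining product rule already prescribes its probability, and the block masses
  determine the space.\<close>

lemma is_indep_prod_block_space_iff:
  fixes P Q :: "('r \<Rightarrow> bool) set pmf"
  assumes P: "block_pmf P" "finite (set_pmf P)" and Q: "block_pmf Q" "finite (set_pmf Q)"
    and ne: "\<And>A B. A \<in> set_pmf P \<Longrightarrow> B \<in> set_pmf Q \<Longrightarrow> A \<inter> B \<noteq> {}"
  shows "is_indep_prod (block_space P) (block_space Q) K \<longleftrightarrow> K = block_space (inter_pmf P Q)"
proof
  have PQ: "block_pmf (inter_pmf P Q)" by (rule block_pmf_inter[OF P(1) Q(1) ne])
  have em: "emeasure (block_space (inter_pmf P Q)) (E1 \<inter> E2) =
      emeasure (block_space P) E1 * emeasure (block_space Q) E2"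
    if "E1 \<in> block_sets P" "E2 \<in> block_sets Q" for E1 E2
  proof -
    have "E1 \<inter> E2 \<in> block_sets (inter_pmf P Q)"
      using that by (simp add: block_sets_def set_inter_pmf) blast
    then show ?thesis
      using emeasure_inter_pmf[OF P(1) Q(1) ne that] by (simp add: emeasure_block_space[OF PQ])
  qed
  show "is_indep_prod (block_space P) (block_space Q) K" if "K = block_space (inter_pmf P Q)"
    using that by (simp add: is_indep_prod_def prob_space_block_space[OF PQ]
        sigma_sets_block_sets_Un[OF P Q] em)
  assume K: "is_indep_prod (block_space P) (block_space Q) K"
  show "K = block_space (inter_pmf P Q)"
  proof (rule block_space_eqI[OF PQ])
    show "finite (set_pmf (inter_pmf P Q))" using P Q by (simp add: inter_pmf_def)
    show "prob_space K" "sets K = block_sets (inter_pmf P Q)"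
      using K by (simp_all add: is_indep_prod_def sigma_sets_block_sets_Un[OF P Q])
    fix X assume X: "X \<in> set_pmf (inter_pmf P Q)"
    then obtain A B where "X = A \<inter> B" "A \<in> block_sets P" "B \<in> block_sets Q"
      using block_mem_sets[OF P(1)] block_mem_sets[OF Q(1)] by (auto simp: set_inter_pmf)
    then show "emeasure K X = pmf (inter_pmf P Q) X"
      using K em emeasure_block[OF PQ X] by (simp add: is_indep_prod_def)
  qed
qed

text \<open>The support of a bind is the union of the supports, so a set respects its blocks iff it
  respects those of every summand. This matches the intersection of the sigma-algebras.\<close>

lemma wsum_block_space:
  assumes K: "\<And>Y. Y \<in> set_pmf \<nu> \<Longrightarrow> block_pmf (K Y) \<and> \<kappa> Y = block_space (K Y)"
    and fin: "finite (set_pmf \<nu>)"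
  shows "wsum \<nu> \<kappa> = block_space (bind_pmf \<nu> K)"
proof -
  have sets: "(\<Inter>Y \<in> set_pmf \<nu>. sets (\<kappa> Y)) = block_sets (bind_pmf \<nu> K)"
    using K by (auto simp: block_sets_def set_bind_pmf)
  have "(\<Sum>Y \<in> set_pmf \<nu>. ennreal (pmf \<nu> Y) * emeasure (\<kappa> Y) E) =
      emeasure (bind_pmf \<nu> K) {A. A \<subseteq> E}" if E: "E \<in> block_sets (bind_pmf \<nu> K)" for E
  proof -
    have "E \<in> block_sets (K Y)" if "Y \<in> set_pmf \<nu>" for Y
      using E that by (auto simp: block_sets_def set_bind_pmf)
    then have "(\<Sum>Y \<in> set_pmf \<nu>. ennreal (pmf \<nu> Y) * emeasure (\<kappa> Y) E) =
        (\<Sum>Y \<in> set_pmf \<nu>. emeasure (K Y) {A. A \<subseteq> E} * ennreal (pmf \<nu> Y))"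
      using K by (intro sum.cong) (auto simp: emeasure_block_space mult.commute)
    also have "\<dots> = emeasure (bind_pmf \<nu> K) {A. A \<subseteq> E}"
      by (simp add: emeasure_bind_pmf nn_integral_measure_pmf_finite fin)
    finally show ?thesis .
  qed
  then show ?thesis
    unfolding wsum_def block_space_def sets
    by (intro measure_of_eq) (simp_all add: sigma_algebra.sigma_sets_eq[OF sigma_algebra_block_sets])
qed

text \<open>\<open>C\<close> is arbitrary off the blocks. It is measurable all the same, since a
  preimage contains or avoids each block and any set off the blocks is an event.\<close>

lemma distr_block_space:
  assumes P: "block_pmf P" and C: "\<And>A \<rho>. A \<in> set_pmf P \<Longrightarrow> \<rho> \<in> A \<Longrightarrow> C \<rho> = c A"
  shows "C \<in> block_space P \<rightarrow>\<^sub>M count_space UNIV"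
    and "distr (block_space P) (count_space UNIV) C = measure_pmf (map_pmf c P)"
proof -
  have pre: "C -` S \<in> block_sets P" for S
    using C by (auto simp: block_sets_def)
  then show meas: "C \<in> block_space P \<rightarrow>\<^sub>M count_space UNIV"
    by (simp add: measurable_def)
  show "distr (block_space P) (count_space UNIV) C = measure_pmf (map_pmf c P)"
  proof (rule measure_eqI)
    fix S :: "'b set"
    have "A \<subseteq> C -` S \<longleftrightarrow> c A \<in> S" if A: "A \<in> set_pmf P" for A
      using C[OF A] block_pmf_nonempty[OF P A] by fastforce
    then have "emeasure P {A. A \<subseteq> C -` S} = emeasure P (c -` S)"
      by (intro emeasure_eq_AE) (auto simp: AE_measure_pmf_iff)
    then show "emeasure (distr (block_space P) (count_space UNIV) C) S = emeasure (map_pmf c P) S"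
      using meas pre by (simp add: emeasure_distr emeasure_block_space P)
  qed simp
qed

text \<open>If \<open>p = 1\<close>, the support holds only the \<open>True\<close> block, and
  completion makes every subset of the \<open>False\<close> half a null event, so one formula covers
  both cases.\<close>

lemma ber_eq_block_space:
  assumes p: "0 < p" "p \<le> 1"
  shows "ber r p = block_space (map_pmf (\<lambda>b. {\<rho>. \<rho> r = b}) (bernoulli_pmf p))"
    and "block_pmf (map_pmf (\<lambda>b. {\<rho>. \<rho> r = b}) (bernoulli_pmf p))"
proof -
  define B where "B b = {\<rho> :: 'a \<Rightarrow> bool. \<rho> r = b}" for b
  let ?\<pi> = "map_pmf B (bernoulli_pmf p)"
  let ?G = "{{\<rho> :: 'a \<Rightarrow> bool. \<rho> r = True}}"
  let ?\<mu> = "\<lambda>E. emeasure (bernoulli_pmf p) ((\<lambda>\<rho>. \<rho> r) ` E)"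
  let ?M = "measure_of UNIV ?G ?\<mu>"
  have B: "(\<lambda>b. {\<rho>. \<rho> r = b}) = B" by (simp add: B_def fun_eq_iff)
  have mem: "(\<lambda>_. b) \<in> B b" for b by (simp add: B_def)
  then have ne: "B b \<noteq> {}" for b by (metis empty_iff)
  have disj: "B b \<inter> B b' = {}" if "b \<noteq> b'" for b b'
    using that by (auto simp: B_def)
  have inj: "inj B"
    using ne disj by (intro injI) (metis inf.idem)
  have img: "(\<lambda>\<rho>. \<rho> r) ` ((\<lambda>\<rho>::'a \<Rightarrow> bool. \<rho> r) -` T) = T" for T
  proof (rule surj_image_vimage_eq)
    show "surj (\<lambda>\<rho>::'a \<Rightarrow> bool. \<rho> r)"
      by (rule surjI[of "\<lambda>\<rho>. \<rho> r" "\<lambda>b _. b"]) (rule refl)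
  qed
  have \<pi>: "block_pmf ?\<pi>"
    unfolding block_pmf_def disjoint_def set_map_pmf
  proof (intro conjI ballI impI notI)
    assume "{} \<in> B ` set_pmf (bernoulli_pmf p)"
    then obtain b where "{} = B b" by (rule imageE)
    with ne[of b] show False by simp
  next
    fix X Y assume X: "X \<in> B ` set_pmf (bernoulli_pmf p)" "Y \<in> B ` set_pmf (bernoulli_pmf p)" "X \<noteq> Y"
    then obtain b b' where "X = B b" "Y = B b'" by (elim imageE)
    moreover from this X(3) have "b \<noteq> b'" by (intro notI) (simp only: simp_thms)
    ultimately show "X \<inter> Y = {}" using disj by simp
  qed
  \<comment> \<open>Enumerating the four sets of booleans identifies the events with the preimages
    under evaluation at \<open>r\<close>. By \<open>img\<close> the set function then becomes the
    Bernoulli measure, from which additivity is inherited.\<close>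
  have gen: "sigma_sets UNIV ?G = range (\<lambda>T. (\<lambda>\<rho>. \<rho> r) -` T)"
  proof -
    have "(UNIV :: bool set set) = Pow {False, True}"
      unfolding UNIV_bool[symmetric] by (rule Pow_UNIV[symmetric])
    also have "\<dots> = {{}, {True}, {False}, UNIV}"
      by (simp only: Pow_insert Pow_empty UNIV_bool) (simp add: insert_commute)
    finally have "range (\<lambda>T. (\<lambda>\<rho>. \<rho> r) -` T) = (\<lambda>T. (\<lambda>\<rho> :: 'a \<Rightarrow> bool. \<rho> r) -` T) ` {{}, {True}, {False}, UNIV}"
      by (simp only:)
    also have "\<dots> = {{}, B True, B False, UNIV}"
      by (simp only: image_insert image_empty vimage_empty vimage_UNIV vimage_def B_def singleton_iff
          mem_Collect_eq) simp
    also have "B False = UNIV - B True" by (auto simp: B_def)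
    also have "{{}, B True, UNIV - B True, UNIV} = sigma_sets UNIV ?G"
      unfolding B_def by (rule sigma_sets_singleton[symmetric]) simp
    finally show ?thesis ..
  qed
  have sets: "sets ?M = range (\<lambda>T. (\<lambda>\<rho>. \<rho> r) -` T)"
    unfolding gen[symmetric] by (rule sets_measure_of) simp
  have em: "emeasure ?M ((\<lambda>\<rho>. \<rho> r) -` T) = emeasure (bernoulli_pmf p) T" for T
  proof -
    have "emeasure ?M ((\<lambda>\<rho>. \<rho> r) -` T) = ?\<mu> ((\<lambda>\<rho>. \<rho> r) -` T)"
    proof (rule emeasure_measure_of[OF refl])
      show "positive (sets ?M) ?\<mu>" by (simp add: positive_def)
      show "countably_additive (sets ?M) ?\<mu>"
      proof (rule countably_additiveI)
        fix F :: "nat \<Rightarrow> ('a \<Rightarrow> bool) set"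
        assume F: "range F \<subseteq> sets ?M" "disjoint_family F"
        define T where "T i = (\<lambda>\<rho>. \<rho> r) ` F i" for i
        have T: "F i = (\<lambda>\<rho>. \<rho> r) -` T i" for i
        proof -
          have "F i \<in> range (\<lambda>T. (\<lambda>\<rho>. \<rho> r) -` T)"
            using F(1) unfolding sets by (rule range_subsetD)
          then obtain S where "F i = (\<lambda>\<rho>. \<rho> r) -` S" by (rule imageE)
          then show ?thesis by (simp only: T_def img)
        qed
        have "(\<lambda>\<rho>. \<rho> r) ` F i = T i" for i
          by (rule T_def[symmetric])
        moreover have "(\<lambda>\<rho>. \<rho> r) ` (\<Union>i. F i) = (\<Union>i. T i)"
          unfolding image_UN T_def ..
        moreover have "disjoint_family T"
          unfolding disjoint_family_on_def
        proof (intro ballI impI)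
          fix i j :: nat assume "i \<noteq> j"
          then have "(\<lambda>\<rho>::'a \<Rightarrow> bool. \<rho> r) -` (T i \<inter> T j) = {}"
            unfolding vimage_Int T[symmetric] using F(2) by (simp add: disjoint_family_on_def)
          then have "(\<lambda>\<rho>. \<rho> r) ` ((\<lambda>\<rho>::'a \<Rightarrow> bool. \<rho> r) -` (T i \<inter> T j)) = {}"
            by (simp only: image_empty)
          then show "T i \<inter> T j = {}" by (simp only: img)
        qed
        ultimately show "(\<Sum>i. ?\<mu> (F i)) = ?\<mu> (\<Union>i. F i)"
          by (simp add: suminf_emeasure)
      qed
      show "(\<lambda>\<rho>. \<rho> r) -` T \<in> sets ?M" unfolding sets by (rule rangeI)
    qed simp
    then show ?thesis by (simp only: img)
  qed
  have "completion ?M = block_space ?\<pi>"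
  proof (rule completion_eq_block_space[OF \<pi>])
    show "prob_space ?M"
      using em[of UNIV] by (intro prob_spaceI) (simp add: space_measure_of_conv emeasure_pmf)
    show "A \<in> sets ?M \<and> emeasure ?M A = pmf ?\<pi> A" if *: "A \<in> set_pmf ?\<pi>" for A
    proof -
      obtain b where A: "A = B b" using * by auto
      then have A': "A = (\<lambda>\<rho>. \<rho> r) -` {b}" by (auto simp: B_def)
      have "pmf ?\<pi> A = pmf (bernoulli_pmf p) b"
        unfolding A by (rule pmf_map_inj'[OF inj])
      then show ?thesis
        unfolding A' em sets by (simp add: emeasure_pmf_single)
    qed
    show "sets ?M \<subseteq> block_sets ?\<pi>"
      unfolding sets by (auto simp: block_sets_def B_def)
  qed (simp_all add: space_measure_of_conv)
  then show "ber r p = block_space (map_pmf (\<lambda>b. {\<rho>. \<rho> r = b}) (bernoulli_pmf p))"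
    by (simp add: ber_def B)
  show "block_pmf (map_pmf (\<lambda>b. {\<rho>. \<rho> r = b}) (bernoulli_pmf p))"
    using \<pi> by (simp add: B)
qed

section \<open>Spaces with finite information\<close>

text \<open>If two different atoms overlap, the overlap is a proper part of one of them and so null.
  As it is nonempty, removing it leaves a proper part, again null, and the atom would be a union of
  two null events.\<close>

lemma atoms_disjoint:
  assumes "X \<in> atoms M" "Y \<in> atoms M" "X \<noteq> Y"
  shows "X \<inter> Y = {}"
proof (rule ccontr)
  assume ne: "X \<inter> Y \<noteq> {}"
  have XY: "X \<in> sets M" "Y \<in> sets M" "X \<inter> Y \<in> sets M"
    using assms by (auto simp: atoms_def)
  have small: "emeasure M Z = 0" if "Z \<in> sets M" "Z \<subset> X \<or> Z \<subset> Y" for Z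
    using assms(1,2) that unfolding atoms_def by blast
  have "X \<inter> Y \<subset> X \<or> X \<inter> Y \<subset> Y" using assms(3) by blast
  with XY(3) have 0: "emeasure M (X \<inter> Y) = 0" by (rule small)
  have big: "emeasure M Z \<noteq> 0" if "Z = X \<or> Z = Y" for Z
    using assms(1,2) that unfolding atoms_def by blast
  have "emeasure M Z = 0" if Z: "Z = X \<or> Z = Y" for Z
  proof -
    have "Z \<in> sets M" using Z XY by blast
    then have "emeasure M Z = emeasure M (X \<inter> Y) + emeasure M (Z - X \<inter> Y)"
      using XY Z by (subst plus_emeasure) (auto intro: arg_cong[where f = "emeasure M"])
    also have "Z - X \<inter> Y \<subset> X \<or> Z - X \<inter> Y \<subset> Y" using Z ne by blast
    then have "emeasure M (Z - X \<inter> Y) = 0"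
      using XY \<open>Z \<in> sets M\<close> by (intro small) simp_all
    finally show ?thesis using 0 by simp
  qed
  with big show False by blast
qed

text \<open>By \<open>ex\<close>, the complement of the atoms is null, so the atom masses sum to 1
  and define \<open>P\<close>. No event cuts an atom, since both pieces would be null, and
  completeness makes every set off the atoms an event.\<close>

lemma complete_atomic_eq_block_space:
  assumes M: "prob_space M" "complete_measure M" "space M = UNIV" and fin: "finite (atoms M)"
    and ex: "\<And>E. E \<in> sets M \<Longrightarrow> emeasure M E \<noteq> 0 \<Longrightarrow> \<exists>A\<in>atoms M. A \<subseteq> E"
  obtains P where "block_pmf P" "set_pmf P = atoms M" "M = block_space P"
proof -
  interpret prob_space M by fact
  interpret complete_measure M by fact
  have sets: "A \<in> sets M" and pos: "emeasure M A \<noteq> 0" if "A \<in> atoms M" for A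
    using that by (simp_all add: atoms_def)
  have ne: "A \<noteq> {}" if "A \<in> atoms M" for A
    using pos[OF that] by (intro notI) simp
  have UN: "\<Union>(atoms M) \<in> sets M"
    using fin sets by (intro sets.finite_Union) auto
  have rest: "- \<Union>(atoms M) \<in> null_sets M"
  proof (rule null_setsI)
    show s: "- \<Union>(atoms M) \<in> sets M"
      using sets.compl_sets[OF UN] M(3) by (simp add: Compl_eq_Diff_UNIV)
    show "emeasure M (- \<Union>(atoms M)) = 0"
    proof (rule ccontr)
      assume "emeasure M (- \<Union>(atoms M)) \<noteq> 0"
      from ex[OF s this] obtain A where "A \<in> atoms M" "A \<subseteq> - \<Union>(atoms M)" by blast
      then have "A = {}" by blast
      with ne[OF \<open>A \<in> atoms M\<close>] show False by simp
    qed
  qed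
  have "measure M (\<Union>(atoms M)) = 1"
  proof -
    have "measure M (- \<Union>(atoms M)) = 0" using rest by (simp add: measure_eq_0_null_sets)
    then show ?thesis using prob_compl[OF UN] M(3) by (simp add: Compl_eq_Diff_UNIV)
  qed
  moreover have "measure M (\<Union>(atoms M)) = (\<Sum>A\<in>atoms M. measure M A)"
  proof -
    have "disjoint_family_on (\<lambda>A. A) (atoms M)"
      unfolding disjoint_family_on_def by (intro ballI impI) (rule atoms_disjoint)
    moreover have "(\<lambda>A. A) ` atoms M \<subseteq> sets M" using sets by auto
    ultimately show ?thesis
      using finite_measure_finite_Union[OF fin, of "\<lambda>A. A"] by simp
  qed
  ultimately have sum: "(\<Sum>A\<in>atoms M. measure M A) = 1" by simp
  define P where "P = embed_pmf (\<lambda>A. if A \<in> atoms M then measure M A else 0)"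
  have pmf: "pmf P A = (if A \<in> atoms M then measure M A else 0)" for A
    unfolding P_def
  proof (rule pmf_embed_pmf)
    have "(\<integral>\<^sup>+A. ennreal (if A \<in> atoms M then measure M A else 0) \<partial>count_space UNIV) =
        (\<Sum>A\<in>atoms M. ennreal (measure M A))"
      using fin by (subst nn_integral_count_space'[of "atoms M"]) auto
    also have "\<dots> = 1" using sum by (simp add: sum_ennreal)
    finally show "(\<integral>\<^sup>+A. ennreal (if A \<in> atoms M then measure M A else 0) \<partial>count_space UNIV) = 1" .
  qed simp
  have set: "set_pmf P = atoms M"
    using pos by (auto simp: set_pmf_iff pmf emeasure_eq_measure split: if_splits)
  have P: "block_pmf P"
    unfolding block_pmf_def disjoint_def set using ne atoms_disjoint by (metis (no_types))
  have "M = block_space P"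
  proof (rule block_space_eqI[OF P _ M(1)])
    show "sets M = block_sets P"
    proof (intro equalityI subsetI)
      fix E assume E: "E \<in> sets M"
      show "E \<in> block_sets P"
        unfolding block_sets_def set
      proof (intro CollectI ballI)
        fix A assume A: "A \<in> atoms M"
        have small: "emeasure M Z = 0" if "Z \<in> sets M" "Z \<subset> A" for Z
          using A that by (simp add: atoms_def)
        show "A \<subseteq> E \<or> A \<inter> E = {}"
        proof (rule ccontr)
          assume "\<not> (A \<subseteq> E \<or> A \<inter> E = {})"
          then have "A \<inter> E \<subset> A" "A - E \<subset> A" by blast+
          moreover have "A \<inter> E \<in> sets M" "A - E \<in> sets M" using sets[OF A] E by simp_all
          ultimately have "emeasure M (A \<inter> E) + emeasure M (A - E) = 0"
            using small by simp
          also have "emeasure M (A \<inter> E) + emeasure M (A - E) = emeasure M A"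
            using sets[OF A] E by (subst plus_emeasure) (auto intro: arg_cong[where f = "emeasure M"])
          finally show False using pos[OF A] by simp
        qed
      qed
    next
      fix E assume E: "E \<in> block_sets P"
      have "\<Union>{A \<in> atoms M. A \<subseteq> E} \<in> sets M"
        using fin sets by (intro sets.finite_Union) auto
      moreover have "E - \<Union>(atoms M) \<in> sets M"
        by (rule complete[OF _ rest]) blast
      moreover have "E = \<Union>{A \<in> atoms M. A \<subseteq> E} \<union> (E - \<Union>(atoms M))"
        using E unfolding block_sets_def set by blast
      ultimately show "E \<in> sets M" by (metis (no_types) sets.Un)
    qed
  qed (simp_all add: set fin pmf emeasure_eq_measure)
  with P set show thesis by (rule that)
qed

section \<open>Products with a trivial space\<close>

lemma sets_triv: "sets (triv S) = {{}, S \<rightarrow>\<^sub>E UNIV}"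
  by (simp add: triv_def sigma_sets_empty_eq)

lemma space_triv: "space (triv S) = (S \<rightarrow>\<^sub>E UNIV)"
  by (simp add: triv_def space_measure_of_conv)

lemma PiE_UNIV_ne: "(S \<rightarrow>\<^sub>E (UNIV :: bool set)) \<noteq> {}"
  by (simp add: PiE_eq_empty_iff)

lemma prob_space_triv: "prob_space (triv S)"
proof (rule prob_spaceI)
  let ?\<Omega> = "S \<rightarrow>\<^sub>E (UNIV :: bool set)"
  have "emeasure (triv S) ?\<Omega> = (if ?\<Omega> = {} then 0 else 1)"
    unfolding triv_def
  proof (rule emeasure_measure_of[OF refl])
    let ?M = "measure_of ?\<Omega> {} (\<lambda>E. if E = {} then 0 else 1)"
    have sets: "sets ?M = {{}, ?\<Omega>}" using sets_triv[of S] unfolding triv_def .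
    show "positive (sets ?M) (\<lambda>E. if E = {} then 0 else 1)" by (simp add: positive_def)
    show "countably_additive (sets ?M) (\<lambda>E. if E = {} then 0 else 1)"
    proof (rule countably_additiveI)
      fix F :: "nat \<Rightarrow> ('a \<Rightarrow> bool) set"
      assume F: "range F \<subseteq> sets ?M" "disjoint_family F" "(\<Union>i. F i) \<in> sets ?M"
      show "(\<Sum>i. if F i = {} then 0 else 1) = (if (\<Union>i. F i) = {} then 0 else 1 :: ennreal)"
      proof (cases "\<exists>i. F i \<noteq> {}")
        case True
        then obtain i where i: "F i \<noteq> {}" by blast
        have *: "F j = {} \<or> F j = ?\<Omega>" for j
          using range_subsetD[OF F(1), of j] unfolding sets by simp
        \<comment> \<open>Two disjoint events cannot both be the whole nonempty space, so at most
          one member of the family is nonempty.\<close>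
        have j: "F j = {}" if "j \<noteq> i" for j
        proof -
          have "F j \<inter> F i = {}" using F(2) that by (simp add: disjoint_family_on_def)
          with i *[of j] *[of i] show ?thesis by (metis inf.idem)
        qed
        have "(\<Sum>j. if F j = {} then 0 else 1 :: ennreal) = (\<Sum>j\<in>{i}. if F j = {} then 0 else 1)"
          by (rule suminf_finite) (simp_all add: j)
        then show ?thesis using i by auto
      qed auto
    qed
    show "?\<Omega> \<in> sets ?M" unfolding sets by simp
  qed simp
  then show "emeasure (triv S) (space (triv S)) = 1"
    by (simp add: space_triv PiE_UNIV_ne)
qed

lemma sets_pair_triv:
  "sets (M \<Otimes>\<^sub>M triv S) = (\<lambda>E. E \<times> (S \<rightarrow>\<^sub>E UNIV)) ` sets M"
proof (intro equalityI subsetI)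
  let ?\<Omega> = "S \<rightarrow>\<^sub>E (UNIV :: bool set)"
  fix X assume "X \<in> sets (M \<Otimes>\<^sub>M triv S)"
  then have "X \<in> sigma_sets (space M \<times> ?\<Omega>) {a \<times> b |a b. a \<in> sets M \<and> b \<in> sets (triv S)}"
    unfolding sets_pair_measure by (simp only: space_triv)
  then show "X \<in> (\<lambda>E. E \<times> ?\<Omega>) ` sets M"
  proof induction
    case (Basic X)
    then obtain a b where "X = a \<times> b" "a \<in> sets M" "b = {} \<or> b = ?\<Omega>"
      by (auto simp: sets_triv)
    \<comment> \<open>A rectangle whose second side is empty is rewritten with an empty first side,
      which gives all rectangles the same second side.\<close>
    then have "X = (if b = {} then {} else a) \<times> ?\<Omega>" "(if b = {} then {} else a) \<in> sets M"
      using PiE_UNIV_ne[of S] by auto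
    then show ?case by (rule image_eqI)
  next
    case Empty
    show ?case by (rule image_eqI[of _ _ "{}"]) simp_all
  next
    case (Compl X)
    then obtain a where "X = a \<times> ?\<Omega>" "a \<in> sets M" by (elim imageE)
    then have "space M \<times> ?\<Omega> - X = (space M - a) \<times> ?\<Omega>" "space M - a \<in> sets M" by auto
    then show ?case by (rule image_eqI)
  next
    case (Union F)
    then have "\<forall>i. \<exists>a. F i = a \<times> ?\<Omega> \<and> a \<in> sets M" by blast
    then obtain a where a: "\<And>i. F i = a i \<times> ?\<Omega>" "\<And>i. a i \<in> sets M" by metis
    have "(\<Union>i. F i) = (\<Union>i. a i) \<times> ?\<Omega>" unfolding a(1) by blast
    moreover have "(\<Union>i. a i) \<in> sets M" using a(2) by blast
    ultimately show ?case by (rule image_eqI)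
  qed
next
  fix X assume "X \<in> (\<lambda>E. E \<times> (S \<rightarrow>\<^sub>E (UNIV :: bool set))) ` sets M"
  then show "X \<in> sets (M \<Otimes>\<^sub>M triv S)" by (auto simp: sets_triv)
qed

definition cylinder :: "'r set \<Rightarrow> ('r \<Rightarrow> bool) set \<Rightarrow> ('r \<Rightarrow> bool) set" where
  "cylinder R E = {\<rho>. restrict \<rho> R \<in> E}"

definition depends_on :: "'r set \<Rightarrow> ('r \<Rightarrow> bool) set \<Rightarrow> bool" where
  "depends_on R E \<longleftrightarrow> (\<exists>E0 \<subseteq> R \<rightarrow>\<^sub>E UNIV. E = cylinder R E0)"

lemma depends_on_iff:
  "depends_on R E \<longleftrightarrow> (\<forall>\<rho> \<in> E. \<forall>\<rho>'. restrict \<rho>' R = restrict \<rho> R \<longrightarrow> \<rho>' \<in> E)"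
proof
  assume "depends_on R E"
  then show "\<forall>\<rho> \<in> E. \<forall>\<rho>'. restrict \<rho>' R = restrict \<rho> R \<longrightarrow> \<rho>' \<in> E"
    by (auto simp: depends_on_def cylinder_def)
next
  assume *: "\<forall>\<rho> \<in> E. \<forall>\<rho>'. restrict \<rho>' R = restrict \<rho> R \<longrightarrow> \<rho>' \<in> E"
  \<comment> \<open>The base of the cylinder is the set of restrictions of the points of
    \<open>E\<close>.\<close>
  have "E = cylinder R ((\<lambda>\<rho>. restrict \<rho> R) ` E)"
    unfolding cylinder_def using * by blast
  moreover have "(\<lambda>\<rho>. restrict \<rho> R) ` E \<subseteq> R \<rightarrow>\<^sub>E UNIV" by auto
  ultimately show "depends_on R E" unfolding depends_on_def by blast
qed

context
  fixes R :: "'r set" and \<psi> T :: "('r \<Rightarrow> bool) measure"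
  assumes \<psi>: "prob_space_on R \<psi>"
  defines "T \<equiv> embed_measure (\<psi> \<Otimes>\<^sub>M triv (- R)) (merge R (- R))"
begin

private lemma space_\<psi>: "space \<psi> = (R \<rightarrow>\<^sub>E UNIV)"
  using \<psi> by (simp add: prob_space_on_def)

private lemma space_pair: "space (\<psi> \<Otimes>\<^sub>M triv (- R)) = (R \<rightarrow>\<^sub>E UNIV) \<times> (- R \<rightarrow>\<^sub>E UNIV)"
  by (simp add: space_pair_measure space_\<psi> space_triv)

private lemma restrict_merge:
  assumes "x \<in> R \<rightarrow>\<^sub>E UNIV" "y \<in> - R \<rightarrow>\<^sub>E UNIV"
  shows "restrict (merge R (- R) (x, y)) R = x" "restrict (merge R (- R) (x, y)) (- R) = y"
  using assms by (auto simp: merge_def fun_eq_iff PiE_def extensional_def)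

text \<open>Restricting to \<open>R\<close> and to its complement recovers the two components only
  if they are extensional, so injectivity holds on the space and not on the whole type.\<close>

private lemma inj_merge: "inj_on (merge R (- R)) (space (\<psi> \<Otimes>\<^sub>M triv (- R)))"
  unfolding space_pair
proof (rule inj_onI, elim SigmaE)
  fix z z' :: "('r \<Rightarrow> bool) \<times> ('r \<Rightarrow> bool)" and x x' y y'
  assume "merge R (- R) z = merge R (- R) z'" "z = (x, y)" "z' = (x', y')"
    "x \<in> R \<rightarrow>\<^sub>E UNIV" "y \<in> - R \<rightarrow>\<^sub>E UNIV" "x' \<in> R \<rightarrow>\<^sub>E UNIV" "y' \<in> - R \<rightarrow>\<^sub>E UNIV"
  then show "z = z'" by (metis restrict_merge)
qed

private lemma image_merge:
  assumes "E \<subseteq> R \<rightarrow>\<^sub>E UNIV"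
  shows "merge R (- R) ` (E \<times> (- R \<rightarrow>\<^sub>E UNIV)) = cylinder R E"
proof (intro equalityI subsetI)
  fix \<rho> assume "\<rho> \<in> merge R (- R) ` (E \<times> (- R \<rightarrow>\<^sub>E UNIV))"
  then obtain x y where "\<rho> = merge R (- R) (x, y)" "x \<in> E" "y \<in> - R \<rightarrow>\<^sub>E UNIV"
    by (elim imageE SigmaE) simp
  then show "\<rho> \<in> cylinder R E"
    using assms restrict_merge(1)[of x y] by (auto simp: cylinder_def)
next
  fix \<rho> assume "\<rho> \<in> cylinder R E"
  then have "(restrict \<rho> R, restrict \<rho> (- R)) \<in> E \<times> (- R \<rightarrow>\<^sub>E UNIV)"
    by (simp add: cylinder_def)
  moreover have "\<rho> = merge R (- R) (restrict \<rho> R, restrict \<rho> (- R))"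
    by (simp add: merge_def fun_eq_iff)
  ultimately show "\<rho> \<in> merge R (- R) ` (E \<times> (- R \<rightarrow>\<^sub>E UNIV))"
    by (metis imageI)
qed

lemma sets_embed_triv: "sets T = cylinder R ` sets \<psi>"
proof -
  have "sets T = (\<lambda>E. merge R (- R) ` (E \<times> (- R \<rightarrow>\<^sub>E UNIV))) ` sets \<psi>"
    unfolding T_def sets_embed_measure'[OF inj_merge] sets_pair_triv by blast
  also have "\<dots> = cylinder R ` sets \<psi>"
    using image_merge sets.sets_into_space[of _ \<psi>] by (intro image_cong) (simp_all add: space_\<psi>)
  finally show ?thesis .
qed

lemma emeasure_embed_triv:
  assumes E: "E \<in> sets \<psi>"
  shows "emeasure T (cylinder R E) = emeasure \<psi> E"
proof -
  interpret prob_space "triv (- R)" by (rule prob_space_triv)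
  let ?X = "E \<times> (- R \<rightarrow>\<^sub>E (UNIV :: bool set))"
  have sub: "E \<subseteq> R \<rightarrow>\<^sub>E UNIV"
    using sets.sets_into_space[OF E] by (simp add: space_\<psi>)
  have "cylinder R E \<in> sets T" unfolding sets_embed_triv using E by (rule imageI)
  then have "emeasure T (cylinder R E) = emeasure (\<psi> \<Otimes>\<^sub>M triv (- R))
      (merge R (- R) -` cylinder R E \<inter> space (\<psi> \<Otimes>\<^sub>M triv (- R)))"
    unfolding T_def by (rule emeasure_embed_measure'[OF inj_merge])
  also have "merge R (- R) -` cylinder R E \<inter> space (\<psi> \<Otimes>\<^sub>M triv (- R)) = ?X"
  proof -
    have "?X \<subseteq> space (\<psi> \<Otimes>\<^sub>M triv (- R))"
      unfolding space_pair using sub by blast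
    then show ?thesis
      unfolding image_merge[OF sub, symmetric] using inj_merge by (auto dest: inj_onD)
  qed
  also have "emeasure (\<psi> \<Otimes>\<^sub>M triv (- R)) ?X =
      emeasure \<psi> E * emeasure (triv (- R)) (- R \<rightarrow>\<^sub>E UNIV)"
    by (rule emeasure_pair_measure_Times) (simp_all add: E sets_triv)
  also have "emeasure (triv (- R)) (- R \<rightarrow>\<^sub>E UNIV) = 1"
    using emeasure_space_1 by (simp add: space_triv)
  finally show ?thesis by simp
qed

lemma space_embed_triv: "space T = UNIV"
proof -
  have "space T = cylinder R (R \<rightarrow>\<^sub>E UNIV)"
    unfolding T_def space_embed_measure space_pair by (rule image_merge) simp
  then show ?thesis by (simp add: cylinder_def)
qed

lemma prob_space_embed_triv: "prob_space T"
proof (rule prob_spaceI)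
  interpret prob_space \<psi> using \<psi> by (simp add: prob_space_on_def)
  have "cylinder R (space \<psi>) = UNIV" by (simp add: cylinder_def space_\<psi>)
  then show "emeasure T (space T) = 1"
    using emeasure_embed_triv[of "space \<psi>"] emeasure_space_1 by (simp add: space_embed_triv)
qed

text \<open>Transfers minimality arguments from the completion to \<open>T\<close>: removing the
  null part that completion added leaves a set depending on \<open>R\<close> only, at no cost in
  probability.\<close>

lemma embed_triv_inner_event:
  assumes "E \<in> sets (completion T)"
  obtains S where "S \<in> sets T" "S \<subseteq> E" "depends_on R S" "emeasure (completion T) S = emeasure (completion T) E"
proof -
  from assms obtain S N N' where *: "E = S \<union> N" "N \<subseteq> N'" "N' \<in> null_sets T" "S \<in> sets T"
    by (rule sets_completionE)
  have "depends_on R S"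
  proof -
    obtain E0 where "S = cylinder R E0" "E0 \<in> sets \<psi>"
      using *(4) unfolding sets_embed_triv by (rule imageE)
    then show ?thesis
      unfolding depends_on_def using sets.sets_into_space[of E0 \<psi>] by (auto simp: space_\<psi>)
  qed
  moreover have "N \<in> null_sets (completion T)"
    using null_sets_completion_iff2 *(2,3) by blast
  then have "emeasure (completion T) E = emeasure (completion T) S"
    unfolding *(1) using *(4) by (intro emeasure_Un_null_set) auto
  ultimately show thesis using that[of S] * by simp
qed

lemma finite_sets_embed_triv:
  assumes "finite R" shows "finite (sets T)"
proof -
  have "finite (R \<rightarrow>\<^sub>E (UNIV :: bool set))" by (rule finite_PiE[OF assms]) simp
  moreover have "sets \<psi> \<subseteq> Pow (R \<rightarrow>\<^sub>E UNIV)"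
    using sets.space_closed[of \<psi>] by (simp add: space_\<psi>)
  ultimately have "finite (sets \<psi>)" by (meson finite_Pow_iff finite_subset)
  then show ?thesis unfolding sets_embed_triv by (rule finite_imageI)
qed

text \<open>The inner event of an atom has the same nonzero probability, so by minimality it cannot
  be a proper subset and must be the atom itself.\<close>

lemma atom_tensor_triv:
  assumes "A \<in> atoms (tensor_triv R \<psi>)"
  shows "A \<in> sets T" "depends_on R A"
proof -
  have A: "A \<in> atoms (completion T)"
    using assms by (simp add: tensor_triv_def T_def)
  then have "A \<in> sets (completion T)" by (simp add: atoms_def)
  then obtain S where S: "S \<in> sets T" "S \<subseteq> A" "depends_on R S"
      "emeasure (completion T) S = emeasure (completion T) A"
    by (rule embed_triv_inner_event)
  have "S \<in> sets (completion T)" using S(1) by (rule sets_completionI_sets)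
  then have "S = A"
    using A S(2,4) unfolding atoms_def by (metis (no_types, lifting) mem_Collect_eq psubsetI)
  with S show "A \<in> sets T" "depends_on R A" by simp_all
qed

text \<open>Among the finitely many positive events of \<open>T\<close> inside \<open>E\<close>
  there is a minimal one. It is also minimal among the completed events, because a positive
  completed event below it would contain a positive event of \<open>T\<close>.\<close>

lemma tensor_triv_contains_atom:
  assumes R: "finite R" and E: "E \<in> sets (tensor_triv R \<psi>)" "emeasure (tensor_triv R \<psi>) E \<noteq> 0"
  shows "\<exists>A\<in>atoms (tensor_triv R \<psi>). A \<subseteq> E"
proof -
  have T: "tensor_triv R \<psi> = completion T" by (simp add: tensor_triv_def T_def)
  define F where "F = {S \<in> sets T. S \<subseteq> E \<and> emeasure (completion T) S \<noteq> 0}"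
  obtain S where "S \<in> sets T" "S \<subseteq> E" "emeasure (completion T) S = emeasure (completion T) E"
    using E(1) unfolding T by (rule embed_triv_inner_event)
  then have "S \<in> F" using E(2) by (simp add: F_def T)
  moreover have "finite F" using finite_sets_embed_triv[OF R] by (simp add: F_def)
  ultimately obtain A where A: "A \<in> F" "\<And>B. B \<in> F \<Longrightarrow> B \<subseteq> A \<Longrightarrow> A = B"
    using finite_has_minimal[of F] by blast
  have "emeasure (completion T) Z = 0" if Z: "Z \<in> sets (completion T)" "Z \<subset> A" for Z
  proof (rule ccontr)
    assume nz: "emeasure (completion T) Z \<noteq> 0"
    obtain S where S: "S \<in> sets T" "S \<subseteq> Z" "emeasure (completion T) S = emeasure (completion T) Z"
      using Z(1) by (rule embed_triv_inner_event)
    with nz A(1) Z(2) have "S \<in> F" unfolding F_def by auto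
    with A(2)[of S] S(2) Z(2) show False by blast
  qed
  then have "A \<in> atoms (completion T)" 
    using A(1) by (simp add: atoms_def F_def del: emeasure_completion)
  moreover have "A \<subseteq> E" using A(1) by (simp add: F_def)
  ultimately show ?thesis unfolding T by blast
qed

end

text \<open>Used with \<open>R = - {r}\<close>, where it turns the freshness condition of a
  collecting step into the insensitivity of every block to the bit \<open>r\<close>.\<close>

lemma block_space_depends_on:
  assumes P: "block_pmf P" and \<psi>: "prob_space_on R \<psi>" and eq: "block_space P = tensor_triv R \<psi>"
    and A: "A \<in> set_pmf P"
  shows "depends_on R A"
  using atom_tensor_triv(2)[OF \<psi>, of A] A unfolding eq[symmetric] atoms_block_space[OF P] .

lemma pspace_imp_block_space:
  assumes "pspace \<psi>"
  obtains P R where "block_pmf P" "finite (set_pmf P)" "\<psi> = block_space P"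
    "finite R" "\<And>A. A \<in> set_pmf P \<Longrightarrow> depends_on R A"
proof -
  from assms obtain R \<psi>R where R: "finite R" "prob_space_on R \<psi>R" "\<psi> = tensor_triv R \<psi>R"
    by (auto simp: pspace_def)
  have fin: "finite (atoms \<psi>)"
  proof (rule finite_subset)
    show "atoms \<psi> \<subseteq> sets (embed_measure (\<psi>R \<Otimes>\<^sub>M triv (- R)) (merge R (- R)))"
      unfolding R(3) using atom_tensor_triv(1)[OF R(2)] by blast
    show "finite (sets (embed_measure (\<psi>R \<Otimes>\<^sub>M triv (- R)) (merge R (- R))))"
      by (rule finite_sets_embed_triv[OF R(2,1)])
  qed
  obtain P where P: "block_pmf P" "set_pmf P = atoms \<psi>" "\<psi> = block_space P"
  proof (rule complete_atomic_eq_block_space[OF _ _ _ fin])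
    show "prob_space \<psi>" "complete_measure \<psi>" "space \<psi> = UNIV"
      using assms by (simp_all add: pspace_def prob_space_on_def)
    show "\<exists>A\<in>atoms \<psi>. A \<subseteq> E" if "E \<in> sets \<psi>" "emeasure \<psi> E \<noteq> 0" for E
      using tensor_triv_contains_atom[OF R(2,1)] that unfolding R(3) by blast
  qed
  show thesis
  proof (rule that[OF P(1) _ P(3) R(1)])
    show "finite (set_pmf P)" using fin P(2) by simp
    show "depends_on R A" if "A \<in> set_pmf P" for A
      using that P(2) atom_tensor_triv(2)[OF R(2)] R(3) by simp
  qed
qed

text \<open>Used in two ways: with a finite \<open>R\<close> to establish \<open>pspace\<close>, and
  with \<open>R = - {r}\<close> to establish freshness. The factor on \<open>R\<close> is the image
  of the block space under restriction to \<open>R\<close>.\<close>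

lemma block_space_eq_tensor_triv:
  assumes P: "block_pmf P" "finite (set_pmf P)" and dep: "\<And>A. A \<in> set_pmf P \<Longrightarrow> depends_on R A"
  shows "\<exists>\<psi>. prob_space_on R \<psi> \<and> block_space P = tensor_triv R \<psi>"
proof -
  let ?\<Omega> = "R \<rightarrow>\<^sub>E (UNIV :: bool set)"
  \<comment> \<open>The largest sigma-algebra on the functions on \<open>R\<close> for which
    restriction to \<open>R\<close> is measurable.\<close>
  define S where "S = {E. E \<subseteq> ?\<Omega> \<and> cylinder R E \<in> block_sets P}"
  interpret B: sigma_algebra UNIV "block_sets P" by (rule sigma_algebra_block_sets)
  have S: "sigma_algebra ?\<Omega> S"
    unfolding sigma_algebra_iff2
  proof (intro conjI ballI allI impI)
    show "S \<subseteq> Pow ?\<Omega>" by (auto simp: S_def)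
    show "{} \<in> S" by (simp add: S_def cylinder_def)
    fix E assume "E \<in> S"
    moreover have "cylinder R (?\<Omega> - E) = UNIV - cylinder R E" by (auto simp: cylinder_def)
    ultimately show "?\<Omega> - E \<in> S" using B.compl_sets[of "cylinder R E"] by (simp add: S_def)
  next
    fix F :: "nat \<Rightarrow> _" assume F: "range F \<subseteq> S"
    then have "F i \<in> S" for i by blast
    then have "F i \<subseteq> ?\<Omega>" "cylinder R (F i) \<in> block_sets P" for i by (simp_all add: S_def)
    moreover from this have "(\<Union>i. cylinder R (F i)) \<in> block_sets P"
      by (intro B.countable_UN) blast
    moreover have "cylinder R (\<Union>i. F i) = (\<Union>i. cylinder R (F i))" by (auto simp: cylinder_def)
    ultimately show "(\<Union>i. F i) \<in> S" by (simp add: S_def UN_least)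
  qed
  \<comment> \<open>Only the sigma-algebra of \<open>?N\<close> matters, as the target of
    \<open>distr\<close>; the zero measure is a placeholder.\<close>
  let ?N = "measure_of ?\<Omega> S (\<lambda>_. 0)"
  have N: "sets ?N = S" "space ?N = ?\<Omega>"
    using S by (simp_all add: sigma_algebra.sets_measure_of_eq sigma_algebra.space_measure_of_eq)
  have meas: "(\<lambda>\<rho>. restrict \<rho> R) \<in> block_space P \<rightarrow>\<^sub>M ?N"
  proof (rule measurableI)
    fix E assume "E \<in> sets ?N"
    then show "(\<lambda>\<rho>. restrict \<rho> R) -` E \<inter> space (block_space P) \<in> sets (block_space P)"
      unfolding N by (simp add: S_def cylinder_def vimage_def)
  qed (simp add: N del: space_measure_of_conv)
  define \<psi> where "\<psi> = distr (block_space P) ?N (\<lambda>\<rho>. restrict \<rho> R)"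
  have sets_\<psi>: "sets \<psi> = S" and space_\<psi>: "space \<psi> = ?\<Omega>"
    using N by (simp_all add: \<psi>_def)
  have em_\<psi>: "emeasure \<psi> E = emeasure (block_space P) (cylinder R E)" if "E \<in> S" for E
    using that meas N by (simp add: \<psi>_def emeasure_distr cylinder_def vimage_def)
  have \<psi>: "prob_space_on R \<psi>"
    using prob_space.prob_space_distr[OF prob_space_block_space[OF P(1)] meas] space_\<psi>
    by (simp add: prob_space_on_def \<psi>_def)
  have "tensor_triv R \<psi> = block_space P"
    unfolding tensor_triv_def
  proof (rule completion_eq_block_space[OF P])
    let ?T = "embed_measure (\<psi> \<Otimes>\<^sub>M triv (- R)) (merge R (- R))"
    show "prob_space ?T" "space ?T = UNIV"
      using prob_space_embed_triv[OF \<psi>] space_embed_triv[OF \<psi>] by simp_all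
    show "sets ?T \<subseteq> block_sets P"
      unfolding sets_embed_triv[OF \<psi>] sets_\<psi> by (auto simp: S_def)
    fix A assume A: "A \<in> set_pmf P"
    then obtain E where E: "E \<subseteq> ?\<Omega>" "A = cylinder R E"
      using dep unfolding depends_on_def by blast
    moreover have "A \<in> block_sets P" using block_mem_sets[OF P(1) A] .
    ultimately have "E \<in> S" by (simp add: S_def)
    then show "A \<in> sets ?T \<and> emeasure ?T A = pmf P A"
      using emeasure_embed_triv[OF \<psi>, of E] em_\<psi>[of E] emeasure_block[OF P(1) A]
      unfolding sets_embed_triv[OF \<psi>] sets_\<psi> E(2) by simp
  qed
  with \<psi> show ?thesis by metis
qed

lemma pspace_block_space:
  assumes P: "block_pmf P" "finite (set_pmf P)"
    and R: "finite R" "\<And>A. A \<in> set_pmf P \<Longrightarrow> depends_on R A"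
  shows "pspace (block_space P)"
  using block_space_eq_tensor_triv[OF P R(2)] R(1)
    prob_space_block_space[OF P(1)] complete_measure_block_space[OF P(1)]
  by (auto simp: pspace_def prob_space_on_def)

section \<open>Splitting an atom\<close>

definition half :: "('r \<Rightarrow> bool) set \<Rightarrow> 'r \<Rightarrow> bool \<Rightarrow> ('r \<Rightarrow> bool) set" where
  "half X r b = X \<inter> {\<rho>. \<rho> r = b}"

definition branch_pmf :: "('r \<Rightarrow> bool) set \<Rightarrow> 'r \<Rightarrow> real \<Rightarrow> ('r \<Rightarrow> bool) set \<Rightarrow> ('r \<Rightarrow> bool) set pmf" where
  "branch_pmf X r p Y = (if X = Y then map_pmf (half X r) (bernoulli_pmf p) else return_pmf Y)"

definition split_pmf ::
    "('r \<Rightarrow> bool) set pmf \<Rightarrow> ('r \<Rightarrow> bool) set \<Rightarrow> 'r \<Rightarrow> real \<Rightarrow> ('r \<Rightarrow> bool) set pmf" where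
  "split_pmf P X r p = bind_pmf P (branch_pmf X r p)"

text \<open>The distribution-level form of a probabilistic step. The \<open>False\<close> half
  appears even when \<open>p = 1\<close>, where the mixture gives it no weight.\<close>

lemma bind_split_pmf:
  "bind_pmf (split_pmf P X r p) f =
    bind_pmf P (\<lambda>Y. if X = Y then mix_pmf p (f (half X r True)) (f (half X r False)) else f Y)"
proof -
  have "bind_pmf (branch_pmf X r p Y) f =
      (if X = Y then mix_pmf p (f (half X r True)) (f (half X r False)) else f Y)" for Y
  proof (cases "X = Y")
    case True
    have *: "f (half X r b) = (if b then f (half X r True) else f (half X r False))" for b
      by (cases b) simp_all
    have "bind_pmf (branch_pmf X r p Y) f = bind_pmf (bernoulli_pmf p) (\<lambda>b. f (half X r b))"
      unfolding branch_pmf_def if_P[OF True] by (rule bind_map_pmf)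
    also have "\<dots> = mix_pmf p (f (half X r True)) (f (half X r False))"
      unfolding mix_pmf_def by (subst *) (rule refl)
    finally show ?thesis using True by simp
  qed (simp add: branch_pmf_def bind_return_pmf)
  then show ?thesis by (simp add: split_pmf_def bind_assoc_pmf)
qed

lemma depends_on_mono: "depends_on R A \<Longrightarrow> R \<subseteq> S \<Longrightarrow> depends_on S A"
  unfolding depends_on_iff by (metis (mono_tags) restrict_restrict inf.absorb_iff2)

lemma depends_on_fun_upd: "depends_on (- {r}) A \<Longrightarrow> \<rho> \<in> A \<Longrightarrow> \<rho>(r := b) \<in> A"
  unfolding depends_on_iff by (metis (no_types, lifting) Compl_iff fun_upd_apply restrict_ext singletonI)

text \<open>Overwriting the bit \<open>r\<close> of a point of \<open>A\<close> stays inside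
  \<open>A\<close>, so both values of the bit occur in \<open>A\<close>.\<close>

lemma half_nonempty:
  assumes "depends_on (- {r}) A" "A \<noteq> {}"
  shows "half A r b \<noteq> {}"
proof -
  obtain \<rho> where "\<rho> \<in> A" using assms(2) by blast
  then have "\<rho>(r := b) \<in> half A r b"
    using depends_on_fun_upd[OF assms(1)] by (simp add: half_def)
  then show ?thesis by blast
qed

lemma half_neq: "half A r True \<noteq> {} \<Longrightarrow> half A r True \<noteq> half A r False"
  by (auto simp: half_def)

lemma depends_on_half: "depends_on R A \<Longrightarrow> depends_on (insert r R) (half A r b)"
proof -
  assume "depends_on R A"
  then have A: "depends_on (insert r R) A" by (rule depends_on_mono) auto
  show ?thesis
    unfolding depends_on_iff
  proof (intro ballI allI impI)
    fix \<rho> \<rho>' assume *: "\<rho> \<in> half A r b" "restrict \<rho>' (insert r R) = restrict \<rho> (insert r R)"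
    have "\<rho>' \<in> A" using A *(1) *(2) unfolding depends_on_iff half_def by blast
    moreover have "\<rho>' r = \<rho> r" using fun_cong[OF *(2), of r] by simp
    ultimately show "\<rho>' \<in> half A r b" using *(1) by (simp add: half_def)
  qed
qed

lemma set_split_pmf_cases:
  assumes "B \<in> set_pmf (split_pmf P X r p)"
  obtains (other) "B \<in> set_pmf P" "B \<noteq> X"
    | (half) b where "B = half X r b" "X \<in> set_pmf P" "b \<in> set_pmf (bernoulli_pmf p)"
proof -
  from assms obtain Y where Y: "Y \<in> set_pmf P" "B \<in> set_pmf (branch_pmf X r p Y)"
    unfolding split_pmf_def set_bind_pmf by blast
  show thesis
  proof (cases "X = Y")
    case True
    then obtain b where "B = half X r b" "b \<in> set_pmf (bernoulli_pmf p)"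
      using Y(2) unfolding branch_pmf_def by auto
    with True Y(1) half show thesis by blast
  next
    case False
    with Y other show thesis by (simp add: branch_pmf_def)
  qed
qed

lemma set_split_pmf_other: "Y \<in> set_pmf P \<Longrightarrow> Y \<noteq> X \<Longrightarrow> Y \<in> set_pmf (split_pmf P X r p)"
  unfolding split_pmf_def set_bind_pmf by (rule UN_I[of Y]) (auto simp: branch_pmf_def)

lemma set_split_pmf_half:
  "X \<in> set_pmf P \<Longrightarrow> b \<in> set_pmf (bernoulli_pmf p) \<Longrightarrow> half X r b \<in> set_pmf (split_pmf P X r p)"
  unfolding split_pmf_def set_bind_pmf by (rule UN_I[of X]) (simp_all add: branch_pmf_def)

lemma block_pmf_half:
  assumes "depends_on (- {r}) X" "X \<noteq> {}"
  shows "block_pmf (map_pmf (half X r) (bernoulli_pmf p))"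
  unfolding block_pmf_def disjoint_def set_map_pmf
proof (intro conjI ballI impI notI)
  assume "{} \<in> half X r ` set_pmf (bernoulli_pmf p)"
  then obtain b where "{} = half X r b" by (rule imageE)
  with half_nonempty[OF assms, of b] show False by simp
next
  fix A B assume "A \<in> half X r ` set_pmf (bernoulli_pmf p)"
    "B \<in> half X r ` set_pmf (bernoulli_pmf p)" "A \<noteq> B"
  then show "A \<inter> B = {}" by (elim imageE) (auto simp: half_def)
qed

lemma block_pmf_branch:
  assumes "depends_on (- {r}) Y" "Y \<noteq> {}"
  shows "block_pmf (branch_pmf X r p Y)"
  using block_pmf_half[OF assms] block_pmf_return[OF assms(2)] by (simp add: branch_pmf_def)

lemma branch_subset: "A \<in> set_pmf (branch_pmf X r p Y) \<Longrightarrow> A \<subseteq> Y"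
  by (auto simp: branch_pmf_def half_def split: if_splits)

lemma block_pmf_bind:
  assumes P: "block_pmf P" and K: "\<And>Y. Y \<in> set_pmf P \<Longrightarrow> block_pmf (K Y)"
    and sub: "\<And>Y A. Y \<in> set_pmf P \<Longrightarrow> A \<in> set_pmf (K Y) \<Longrightarrow> A \<subseteq> Y"
  shows "block_pmf (bind_pmf P K)"
  unfolding block_pmf_def disjoint_def set_bind_pmf
proof (intro conjI ballI impI notI)
  assume "{} \<in> (\<Union>Y\<in>set_pmf P. set_pmf (K Y))"
  then obtain Y where "Y \<in> set_pmf P" "{} \<in> set_pmf (K Y)" by (rule UN_E)
  then show False using K[of Y] by (simp add: block_pmf_def)
next
  fix A B assume "A \<in> (\<Union>Y\<in>set_pmf P. set_pmf (K Y))" "B \<in> (\<Union>Y\<in>set_pmf P. set_pmf (K Y))" "A \<noteq> B"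
  then obtain Y Z where YZ: "Y \<in> set_pmf P" "Z \<in> set_pmf P" "A \<in> set_pmf (K Y)" "B \<in> set_pmf (K Z)"
    by (elim UN_E)
  show "A \<inter> B = {}"
  proof (cases "Y = Z")
    case True
    with YZ K[of Y] \<open>A \<noteq> B\<close> show ?thesis by (simp add: block_pmf_def disjoint_def)
  next
    case False
    with sub[OF YZ(1,3)] sub[OF YZ(2,4)] block_pmf_disjoint[OF P YZ(1,2)] show ?thesis by blast
  qed
qed

section \<open>Conditioning, product and weighted sum combined into a split\<close>

context
  fixes P :: "('r \<Rightarrow> bool) set pmf" and X r and p :: real
  assumes P: "block_pmf P" "finite (set_pmf P)" and X: "X \<in> set_pmf P"
    and dep: "\<And>A. A \<in> set_pmf P \<Longrightarrow> depends_on (- {r}) A"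
begin

lemma block_pmf_split: "block_pmf (split_pmf P X r p)"
  unfolding split_pmf_def
proof (rule block_pmf_bind[OF P(1)])
  show "block_pmf (branch_pmf X r p Y)" if "Y \<in> set_pmf P" for Y
    using dep[OF that] block_pmf_nonempty[OF P(1) that] by (rule block_pmf_branch)
qed (rule branch_subset)

lemma finite_set_split_pmf: "finite (set_pmf (split_pmf P X r p))"
  unfolding split_pmf_def set_bind_pmf branch_pmf_def using P(2) by auto

text \<open>A half is a nonempty part of \<open>X\<close>, and different blocks are disjoint. Hence
  a half never coincides with one of the remaining blocks.\<close>

lemma half_not_in: "half X r b \<in> set_pmf P \<Longrightarrow> half X r b = X"
proof (rule ccontr)
  assume *: "half X r b \<in> set_pmf P" "half X r b \<noteq> X"
  have "half X r b \<inter> X = {}" by (rule block_pmf_disjoint[OF P(1) *(1) X *(2)])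
  then have "half X r b = {}" by (auto simp: half_def)
  with half_nonempty[OF dep[OF X] block_pmf_nonempty[OF P(1) X]] show False by blast
qed

text \<open>Conditioning on \<open>Y\<close> leaves one block. A product with the bit cuts it into
  its halves, which are nonempty by freshness of \<open>r\<close>; a product with
  \<open>psi0\<close> intersects it with the whole space and leaves it unchanged.\<close>

lemma is_indep_prod_cond_space_iff:
  assumes p: "0 < p" "p \<le> 1" and Y: "Y \<in> set_pmf P"
  shows "is_indep_prod (cond_space (block_space P) Y) (if X = Y then ber r p else psi0) K \<longleftrightarrow>
    K = block_space (branch_pmf X r p Y)"
proof (cases "X = Y")
  case True
  have ne: "X \<noteq> {}" using block_pmf_nonempty[OF P(1) X] .
  have "inter_pmf (return_pmf X) (map_pmf (\<lambda>b. {\<rho>. \<rho> r = b}) (bernoulli_pmf p)) = branch_pmf X r p X"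
    by (simp add: inter_pmf_def pair_return_pmf1 pmf.map_comp o_def branch_pmf_def half_def[abs_def])
  moreover have "A \<inter> B \<noteq> {}" if A: "A \<in> set_pmf (return_pmf X)" and
    B: "B \<in> set_pmf (map_pmf (\<lambda>b. {\<rho>. \<rho> r = b}) (bernoulli_pmf p))" for A B
  proof -
    have "A = X" using A by simp
    moreover obtain b where "B = {\<rho>. \<rho> r = b}" using B unfolding set_map_pmf by (rule imageE)
    ultimately show ?thesis using half_nonempty[OF dep[OF X] ne, of b] by (simp add: half_def)
  qed
  ultimately show ?thesis
    unfolding True[symmetric] if_P[OF refl] cond_space_block_space[OF P(1) X] ber_eq_block_space(1)[OF p]
    using is_indep_prod_block_space_iff[OF block_pmf_return[OF ne] _ ber_eq_block_space(2)[OF p, of r], of K]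
    by simp
next
  case False
  have ne: "Y \<noteq> {}" using block_pmf_nonempty[OF P(1) Y] .
  have "inter_pmf (return_pmf Y) (return_pmf UNIV) = branch_pmf X r p Y"
    using False by (simp add: inter_pmf_def pair_return_pmf1 branch_pmf_def)
  then show ?thesis
    unfolding cond_space_block_space[OF P(1) Y] if_not_P[OF False] psi0_eq_block_space
    using is_indep_prod_block_space_iff[OF block_pmf_return[OF ne] _ block_pmf_return[of UNIV], of K] ne
    by simp
qed

text \<open>All blocks of \<open>\<kappa> Y\<close> lie inside \<open>Y\<close>, so the complement
  of \<open>Y\<close> is a null event and the support is confined to \<open>Y\<close>.\<close>

lemma wsum_defined_branch:
  assumes \<kappa>: "\<And>Y. Y \<in> set_pmf P \<Longrightarrow> \<kappa> Y = block_space (branch_pmf X r p Y)"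
  shows "wsum_defined P \<kappa>"
proof -
  have "support (\<kappa> Y) \<subseteq> Y" if Y: "Y \<in> set_pmf P" for Y
  proof -
    have B: "block_pmf (branch_pmf X r p Y)"
      using dep[OF Y] block_pmf_nonempty[OF P(1) Y] by (rule block_pmf_branch)
    have disj: "\<forall>A\<in>set_pmf (branch_pmf X r p Y). A \<inter> - Y = {}"
      by (auto dest!: branch_subset)
    then have "- Y \<in> block_sets (branch_pmf X r p Y)"
      by (simp add: block_sets_def)
    with disj emeasure_block_space_eq_0_iff[OF B] have "- Y \<in> null_sets (\<kappa> Y)"
      by (simp add: \<kappa>[OF Y] null_sets_def)
    then show ?thesis unfolding support_def by blast
  qed
  then have "disjoint_family_on (\<lambda>Y. support (\<kappa> Y)) (set_pmf P)"
    unfolding disjoint_family_on_def using block_pmf_disjoint[OF P(1)] by (meson disjoint_iff subset_iff)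
  with P(2) show ?thesis by (simp add: wsum_defined_def)
qed

lemma wsum_split:
  assumes \<kappa>: "\<And>Y. Y \<in> set_pmf P \<Longrightarrow> \<kappa> Y = block_space (branch_pmf X r p Y)"
  shows "wsum P \<kappa> = block_space (split_pmf P X r p)"
  unfolding split_pmf_def
proof (rule wsum_block_space[OF _ P(2)])
  show "block_pmf (branch_pmf X r p Y) \<and> \<kappa> Y = block_space (branch_pmf X r p Y)"
    if "Y \<in> set_pmf P" for Y
    using \<kappa>[OF that] block_pmf_branch[OF dep[OF that] block_pmf_nonempty[OF P(1) that]] by simp
qed

lemma atom_distribution_iff:
  "(\<forall>Y. pmf \<nu> Y = (if Y \<in> atoms (block_space P) then measure (block_space P) Y else 0)) \<longleftrightarrow> \<nu> = P"
proof -
  have "(if Y \<in> atoms (block_space P) then measure (block_space P) Y else 0) = pmf P Y" for Y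
    using emeasure_block[OF P(1), of Y]
    by (simp add: atoms_block_space[OF P(1)] measure_def set_pmf_iff)
  then show ?thesis by (auto intro: pmf_eqI)
qed

text \<open>The quantifiers collapse: \<open>\<nu>\<close> can only be \<open>P\<close>, and
  \<open>\<kappa>\<close> is forced on the blocks, which are the only arguments that the weighted
  sum reads.\<close>

lemma wsum_atoms_iff:
  assumes p: "0 < p" "p \<le> 1"
  shows "(\<exists>\<nu> \<kappa>. (\<forall>Y. pmf \<nu> Y = (if Y \<in> atoms (block_space P) then measure (block_space P) Y else 0)) \<and>
      (\<forall>Y \<in> atoms (block_space P).
        is_indep_prod (cond_space (block_space P) Y) (if X = Y then ber r p else psi0) (\<kappa> Y)) \<and>
      wsum_defined \<nu> \<kappa> \<and> \<psi> = wsum \<nu> \<kappa>) \<longleftrightarrow> \<psi> = block_space (split_pmf P X r p)"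
    (is "?L \<longleftrightarrow> ?R")
proof -
  have "?L \<longleftrightarrow> (\<exists>\<kappa>. (\<forall>Y \<in> set_pmf P. \<kappa> Y = block_space (branch_pmf X r p Y)) \<and>
      wsum_defined P \<kappa> \<and> \<psi> = wsum P \<kappa>)"
    unfolding atom_distribution_iff unfolding atoms_block_space[OF P(1)]
    using is_indep_prod_cond_space_iff[OF p] by simp
  also have "\<dots> \<longleftrightarrow> ?R"
  proof
    assume ?R
    show "\<exists>\<kappa>. (\<forall>Y \<in> set_pmf P. \<kappa> Y = block_space (branch_pmf X r p Y)) \<and>
        wsum_defined P \<kappa> \<and> \<psi> = wsum P \<kappa>"
      using \<open>?R\<close> wsum_defined_branch[of "\<lambda>Y. block_space (branch_pmf X r p Y)"]
        wsum_split[of "\<lambda>Y. block_space (branch_pmf X r p Y)"]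
      by (intro exI[of _ "\<lambda>Y. block_space (branch_pmf X r p Y)"]) simp
  next
    assume "\<exists>\<kappa>. (\<forall>Y \<in> set_pmf P. \<kappa> Y = block_space (branch_pmf X r p Y)) \<and>
        wsum_defined P \<kappa> \<and> \<psi> = wsum P \<kappa>"
    then show ?R by (elim exE conjE) (simp add: wsum_split)
  qed
  finally show ?thesis .
qed

end

lemma cstepE:
  assumes lang: "language step" and P: "block_pmf P" "finite (set_pmf P)"
    and cstep: "cstep step (block_space P, C1) (\<psi>2, C2)"
  obtains X r c1 c2 p where "X \<in> set_pmf P" "\<And>A. A \<in> set_pmf P \<Longrightarrow> depends_on (- {r}) A"
    "0 < p" "p \<le> 1" "\<psi>2 = block_space (split_pmf P X r p)"
    "\<And>\<rho>. \<rho> \<in> X \<Longrightarrow> step (C1 \<rho>) c1 c2 p" "\<And>\<rho>. \<rho> \<in> X \<Longrightarrow> C2 (\<rho>(r := True)) = c1"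
    "\<And>\<rho>. \<rho> \<in> X \<Longrightarrow> p \<noteq> 1 \<Longrightarrow> C2 (\<rho>(r := False)) = c2"
    "\<And>Y \<rho>. Y \<in> set_pmf P \<Longrightarrow> Y \<noteq> X \<Longrightarrow> \<rho> \<in> Y \<Longrightarrow> C2 \<rho> = C1 \<rho>"
proof -
  from cstep obtain X r e1 \<sigma>1 e2 \<sigma>2 p \<psi>' \<nu> \<kappa> where
    X: "X \<in> atoms (block_space P)" and
    \<psi>': "prob_space_on (- {r}) \<psi>'" "block_space P = tensor_triv (- {r}) \<psi>'" and
    \<nu>: "\<forall>Y. pmf \<nu> Y = (if Y \<in> atoms (block_space P) then measure (block_space P) Y else 0)" and
    \<kappa>: "\<forall>Y \<in> atoms (block_space P).
        is_indep_prod (cond_space (block_space P) Y) (if X = Y then ber r p else psi0) (\<kappa> Y)" and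
    wsum: "wsum_defined \<nu> \<kappa>" "\<psi>2 = wsum \<nu> \<kappa>" and
    steps: "\<forall>\<rho> \<in> X. step (C1 \<rho>) (e1, \<sigma>1) (e2, \<sigma>2) p" and
    C2: "\<forall>\<rho> \<in> X. C2 (\<rho>(r := True)) = (e1, \<sigma>1) \<and> (p \<noteq> 1 \<longrightarrow> C2 (\<rho>(r := False)) = (e2, \<sigma>2))"
    "\<forall>Y \<in> atoms (block_space P). Y \<noteq> X \<longrightarrow> (\<forall>\<rho> \<in> Y. C1 \<rho> = C2 \<rho>)"
    unfolding cstep_def prod.case by (elim exE conjE) (rule that, assumption+)
  have X: "X \<in> set_pmf P" using X unfolding atoms_block_space[OF P(1)] .
  have dep: "depends_on (- {r}) A" if "A \<in> set_pmf P" for A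
    using P(1) \<psi>' that by (rule block_space_depends_on)
  \<comment> \<open>The bounds on \<open>p\<close> come from the step taken at some point of
    \<open>X\<close>.\<close>
  obtain \<rho> where "\<rho> \<in> X" using block_pmf_nonempty[OF P(1) X] by blast
  then have p: "0 < p" "p \<le> 1" using steps language.step_prob[OF lang] by blast+
  have "\<psi>2 = block_space (split_pmf P X r p)"
  proof (rule wsum_atoms_iff[OF P X dep p, THEN iffD1])
    show "\<exists>\<nu> \<kappa>. (\<forall>Y. pmf \<nu> Y = (if Y \<in> atoms (block_space P) then measure (block_space P) Y else 0)) \<and>
        (\<forall>Y \<in> atoms (block_space P).
          is_indep_prod (cond_space (block_space P) Y) (if X = Y then ber r p else psi0) (\<kappa> Y)) \<and>
        wsum_defined \<nu> \<kappa> \<and> \<psi>2 = wsum \<nu> \<kappa>"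
      by (intro exI conjI) (fact \<nu> \<kappa> wsum)+
  qed
  with X dep p steps C2 show thesis
    unfolding atoms_block_space[OF P(1)] by (intro that[of X r p "(e1, \<sigma>1)" "(e2, \<sigma>2)"]) auto
qed

lemma cstepI:
  assumes lang: "language step" and P: "block_pmf P" "finite (set_pmf P)"
    and ps: "pspace (block_space P)" "pspace (block_space (split_pmf P X r p))"
    and X: "X \<in> set_pmf P" and dep: "\<And>A. A \<in> set_pmf P \<Longrightarrow> depends_on (- {r}) A"
    and steps: "\<And>\<rho>. \<rho> \<in> X \<Longrightarrow> step (C1 \<rho>) c1 c2 p"
    and C2: "\<And>\<rho>. \<rho> \<in> X \<Longrightarrow> C2 (\<rho>(r := True)) = c1" "\<And>\<rho>. \<rho> \<in> X \<Longrightarrow> p \<noteq> 1 \<Longrightarrow> C2 (\<rho>(r := False)) = c2"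
      "\<And>Y \<rho>. Y \<in> set_pmf P \<Longrightarrow> Y \<noteq> X \<Longrightarrow> \<rho> \<in> Y \<Longrightarrow> C2 \<rho> = C1 \<rho>"
  shows "cstep step (block_space P, C1) (block_space (split_pmf P X r p), C2)"
proof -
  obtain \<rho> where "\<rho> \<in> X" using block_pmf_nonempty[OF P(1) X] by blast
  then have p: "0 < p" "p \<le> 1" using steps language.step_prob[OF lang] by blast+
  show ?thesis
    unfolding cstep_def prod.case
  proof (intro conjI ps, rule exI[of _ X], rule exI[of _ r], rule exI[of _ "fst c1"],
      rule exI[of _ "snd c1"], rule exI[of _ "fst c2"], rule exI[of _ "snd c2"], rule exI[of _ p],
      intro conjI)
    show "X \<in> atoms (block_space P)" using X unfolding atoms_block_space[OF P(1)] .
    show "\<forall>\<rho>\<in>X. step (C1 \<rho>) (fst c1, snd c1) (fst c2, snd c2) p" using steps by simp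
    show "\<forall>\<rho>\<in>X. C2 (\<rho>(r := True)) = (fst c1, snd c1) \<and> (p \<noteq> 1 \<longrightarrow> C2 (\<rho>(r := False)) = (fst c2, snd c2))"
      using C2 by simp
    show "\<forall>Y\<in>atoms (block_space P). Y \<noteq> X \<longrightarrow> (\<forall>\<rho>\<in>Y. C1 \<rho> = C2 \<rho>)"
      unfolding atoms_block_space[OF P(1)] using C2(3) by simp
    show "\<exists>\<nu> \<kappa>. (\<forall>Y. pmf \<nu> Y = (if Y \<in> atoms (block_space P) then measure (block_space P) Y else 0)) \<and>
        (\<forall>Y \<in> atoms (block_space P).
          is_indep_prod (cond_space (block_space P) Y) (if X = Y then ber r p else psi0) (\<kappa> Y)) \<and>
        wsum_defined \<nu> \<kappa> \<and> block_space (split_pmf P X r p) = wsum \<nu> \<kappa>"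
      by (rule wsum_atoms_iff[OF P X dep p, THEN iffD2]) (assumption, rule refl)
    show "\<exists>\<psi>'. prob_space_on (- {r}) \<psi>' \<and> block_space P = tensor_triv (- {r}) \<psi>'"
      by (rule block_space_eq_tensor_triv[OF P dep])
  qed
qed

section \<open>The two semantics\<close>

lemma mix_pmf_1 [simp]: "mix_pmf 1 \<mu>1 \<mu>2 = \<mu>1"
proof -
  have "bernoulli_pmf 1 = return_pmf True"
    by (rule pmf_eqI) (simp add: pmf_return indicator_def split: bool.split)
  then show ?thesis by (simp add: mix_pmf_def bind_return_pmf)
qed

lemma bernoulli_pmf_support:
  assumes "0 < p" "p \<le> 1"
  shows "True \<in> set_pmf (bernoulli_pmf p)" "False \<in> set_pmf (bernoulli_pmf p) \<longleftrightarrow> p \<noteq> 1"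
  using assms by (auto simp: set_pmf_iff)

text \<open>Constancy on blocks survives a split: all other blocks keep their configuration, and
  each half in the support carries a single successor. \<open>P\<close> varies in the induction
  because every step refines it.\<close>

lemma bigstep_imp_std_bigstep:
  assumes lang: "language step"
    and "bigstep Val step a b" "block_pmf P" "fst a = block_space P"
    and "\<And>A. A \<in> set_pmf P \<Longrightarrow> \<exists>c. \<forall>\<rho>\<in>A. snd a \<rho> = c"
  shows "\<exists>f. (\<forall>A\<in>set_pmf P. \<forall>\<rho>\<in>A. std_bigstep Val step (snd a \<rho>) (f A)) \<and>
    distr (fst b) (count_space UNIV) (snd b) = measure_pmf (bind_pmf P f)"
  using assms(2-)
proof (induction arbitrary: P rule: bigstep.induct)
  case (val \<psi> C C')
  note prems = val.prems[unfolded fst_conv snd_conv]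
  define E where "E = {\<rho>. C \<rho> = C' \<rho>}"
  have E1: "emeasure (block_space P) E = 1" using val.hyps(2) prems(2) by (simp add: E_def)
  \<comment> \<open>A set that is not an event would have \<open>emeasure\<close> 0 instead of
    1.\<close>
  then have "E \<in> block_sets P"
    using emeasure_notin_sets[of E "block_space P"] by (metis sets_block_space zero_neq_one)
  with E1 have E: "A \<subseteq> E" if "A \<in> set_pmf P" for A
    using that emeasure_block_space_eq_1_iff[OF prems(1)] by blast
  obtain c where c: "\<And>A \<rho>. A \<in> set_pmf P \<Longrightarrow> \<rho> \<in> A \<Longrightarrow> C \<rho> = c A"
    using prems(3) by metis
  have C': "C' \<rho> = c A" if "A \<in> set_pmf P" "\<rho> \<in> A" for A \<rho>
    using E[OF that(1)] that c[OF that] unfolding E_def by auto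
  have "std_bigstep Val step (C \<rho>) (return_pmf (c A))" if A: "A \<in> set_pmf P" "\<rho> \<in> A" for A \<rho>
  proof -
    have "C' \<rho> \<in> Val \<times> UNIV" using val.hyps by blast
    then obtain v s where "c A = (v, s)" "v \<in> Val" using C'[OF A] by auto
    then show ?thesis using c[OF A] std_bigstep.val[of v Val step s] by simp
  qed
  moreover have "distr \<psi> (count_space UNIV) C' = measure_pmf (bind_pmf P (\<lambda>A. return_pmf (c A)))"
    using distr_block_space(2)[OF prems(1), of C' c] C' unfolding prems(2)
    by (simp add: map_pmf_def)
  ultimately show ?case
    unfolding fst_conv snd_conv by (intro exI[of _ "\<lambda>A. return_pmf (c A)"]) simp
next
  case (step \<psi>1 C1 \<psi>2 C2 \<psi>' C')
  note prems = step.prems[unfolded fst_conv snd_conv]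
  have ps: "pspace (block_space P)"
    using step.hyps(1) prems(2) by (simp add: cstep_def)
  \<comment> \<open>The finiteness of \<open>P\<close> is recovered from \<open>pspace\<close>,
    which every collecting step demands of its source.\<close>
  have fin: "finite (set_pmf P)"
    using ps atoms_block_space[OF prems(1)] by (elim pspace_imp_block_space) (metis atoms_block_space)
  note P = prems(1) fin
  obtain X r c1 c2 p where X: "X \<in> set_pmf P" and dep: "\<And>A. A \<in> set_pmf P \<Longrightarrow> depends_on (- {r}) A"
    and p: "0 < p" "p \<le> 1" and \<psi>2: "\<psi>2 = block_space (split_pmf P X r p)"
    and steps: "\<And>\<rho>. \<rho> \<in> X \<Longrightarrow> step (C1 \<rho>) c1 c2 p"
    and C2: "\<And>\<rho>. \<rho> \<in> X \<Longrightarrow> C2 (\<rho>(r := True)) = c1"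
      "\<And>\<rho>. \<rho> \<in> X \<Longrightarrow> p \<noteq> 1 \<Longrightarrow> C2 (\<rho>(r := False)) = c2"
      "\<And>Y \<rho>. Y \<in> set_pmf P \<Longrightarrow> Y \<noteq> X \<Longrightarrow> \<rho> \<in> Y \<Longrightarrow> C2 \<rho> = C1 \<rho>"
    using lang P step.hyps(1)[unfolded prems(2)] by (rule cstepE) (assumption | blast)+
  \<comment> \<open>On the half with value \<open>b\<close>, updating \<open>r\<close> to
    \<open>b\<close> changes nothing, so the conditions on updated points describe \<open>C2\<close>
    on all of the half.\<close>
  have C2_half: "C2 \<rho> = (if b then c1 else c2)"
    if "\<rho> \<in> half X r b" "b \<in> set_pmf (bernoulli_pmf p)" for \<rho> b
  proof -
    have "\<rho> \<in> X" "\<rho>(r := b) = \<rho>" using that(1) by (auto simp: half_def)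
    then show ?thesis
      using C2(1)[of \<rho>] C2(2)[of \<rho>] bernoulli_pmf_support(2)[OF p] that(2) by (cases b) auto
  qed
  have const2: "\<exists>c. \<forall>\<rho>\<in>B. C2 \<rho> = c" if "B \<in> set_pmf (split_pmf P X r p)" for B
    using that
  proof (cases rule: set_split_pmf_cases)
    case other
    then show ?thesis using C2(3) prems(3) by metis
  next
    case (half b)
    then show ?thesis using C2_half by blast
  qed
  obtain f where f: "\<And>B \<rho>. B \<in> set_pmf (split_pmf P X r p) \<Longrightarrow> \<rho> \<in> B \<Longrightarrow> std_bigstep Val step (C2 \<rho>) (f B)"
    and distr: "distr \<psi>' (count_space UNIV) C' = measure_pmf (bind_pmf (split_pmf P X r p) f)"
    using step.IH[OF block_pmf_split[OF P X dep], unfolded fst_conv snd_conv, OF _ \<psi>2 const2] by blast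
  define g where "g A = (if X = A then mix_pmf p (f (half X r True)) (f (half X r False)) else f A)" for A
  have f_half: "std_bigstep Val step (if b then c1 else c2) (f (half X r b))"
    if b: "b \<in> set_pmf (bernoulli_pmf p)" for b
  proof -
    obtain \<rho> where "\<rho> \<in> half X r b"
      using half_nonempty[OF dep[OF X] block_pmf_nonempty[OF P(1) X]] by blast
    then show ?thesis using f[OF set_split_pmf_half[OF X b]] C2_half[OF _ b] by metis
  qed
  have "std_bigstep Val step (C1 \<rho>) (g A)" if A: "A \<in> set_pmf P" "\<rho> \<in> A" for A \<rho>
  proof (cases "X = A")
    case False
    then have "C2 \<rho> = C1 \<rho>" using C2(3) A by metis
    then show ?thesis
      using f[OF set_split_pmf_other[OF A(1), of X r p] A(2)] False by (simp add: g_def)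
  next
    case True
    then have st: "step (C1 \<rho>) c1 c2 p" using steps A(2) by simp
    have T: "std_bigstep Val step c1 (f (half X r True))"
      using f_half[of True] bernoulli_pmf_support(1)[OF p] by simp
    show ?thesis
    \<comment> \<open>For \<open>p = 1\<close> the \<open>False\<close> half is not a block, so
      nothing is known about \<open>f\<close> there; rule \<open>det\<close> asks for no derivation
      from \<open>c2\<close>.\<close>
    proof (cases "p = 1")
      case p1: True
      show ?thesis using std_bigstep.det[OF st[unfolded p1] T] True p1 by (simp add: g_def)
    next
      case False
      then have "std_bigstep Val step c2 (f (half X r False))"
        using f_half[of False] bernoulli_pmf_support(2)[OF p] by simp
      then show ?thesis using std_bigstep.prob[OF st T] True by (simp add: g_def)
    qed
  qed
  moreover have "bind_pmf (split_pmf P X r p) f = bind_pmf P g"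
    unfolding bind_split_pmf g_def ..
  ultimately show ?case
    unfolding fst_conv snd_conv using distr by (intro exI[of _ g]) simp
qed

section \<open>From standard derivations to collecting runs\<close>

text \<open>
  A deterministic step is the case \<open>p = 1\<close>, where the second successor need not have a result and
  its distribution is arbitrary.
\<close>

inductive sized_bigstep ::
    "'e set \<Rightarrow> ('e, 's) step_rel \<Rightarrow> ('e, 's) config \<Rightarrow> ('e, 's) config pmf \<Rightarrow> nat \<Rightarrow> bool"
  for Val :: "'e set" and step :: "('e, 's) step_rel" where
  val: "c \<in> Val \<times> UNIV \<Longrightarrow> sized_bigstep Val step c (return_pmf c) 0"
| step: "step c c1 c2 p \<Longrightarrow> sized_bigstep Val step c1 \<mu>1 n1 \<Longrightarrow>
    (p \<noteq> 1 \<longrightarrow> sized_bigstep Val step c2 \<mu>2 n2) \<Longrightarrow>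
    sized_bigstep Val step c (mix_pmf p \<mu>1 \<mu>2) (Suc (n1 + n2))"

lemma std_bigstep_imp_sized: "std_bigstep Val step c \<mu> \<Longrightarrow> \<exists>n. sized_bigstep Val step c \<mu> n"
proof (induction rule: std_bigstep.induct)
  case (val v \<sigma>)
  then show ?case using sized_bigstep.val[of "(v, \<sigma>)" Val step] by auto
next
  case (det c c1 c2 \<mu>)
  then obtain n where "sized_bigstep Val step c1 \<mu> n" by blast
  \<comment> \<open>With \<open>p = 1\<close> the second distribution and size are free;
    \<open>\<mu>\<close> and 0 are fillers, and \<open>mix_pmf_1\<close> removes the
    mixture.\<close>
  then show ?case using sized_bigstep.step[of step c c1 c2 1 Val \<mu> n \<mu> 0] det(1) by auto
next
  case (prob c c1 c2 p \<mu>1 \<mu>2)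
  then show ?case using sized_bigstep.step[of step c c1 c2 p Val] by blast
qed

text \<open>\<open>R\<close> collects the bits on which the blocks may depend. It stays finite, so
  an identifier outside \<open>R\<close> is always available for the next split. Since
  \<open>c\<close>, \<open>f\<close> and \<open>m\<close> are indexed by blocks, they are
  re-assigned after each split.\<close>

lemma sized_bigstep_imp_bigstep:
  fixes P :: "('r \<Rightarrow> bool) set pmf"
  assumes lang: "language step" and inf: "infinite (UNIV :: 'r set)"
    and P: "block_pmf P" "finite (set_pmf P)"
    and R: "finite R" "\<And>A. A \<in> set_pmf P \<Longrightarrow> depends_on R A"
    and C: "\<And>A \<rho>. A \<in> set_pmf P \<Longrightarrow> \<rho> \<in> A \<Longrightarrow> C \<rho> = c A"
    and sized: "\<And>A. A \<in> set_pmf P \<Longrightarrow> sized_bigstep Val step (c A) (f A) (m A)"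
  shows "\<exists>\<psi> C'. pspace \<psi> \<and> C' \<in> \<psi> \<rightarrow>\<^sub>M count_space UNIV \<and>
    distr \<psi> (count_space UNIV) C' = measure_pmf (bind_pmf P f) \<and>
    bigstep Val step (block_space P, C) (\<psi>, C')"
  using P R C sized
proof (induction "\<Sum>A\<in>set_pmf P. m A" arbitrary: P R C c f m rule: less_induct)
  case less
  note P = less.prems(1,2) and R = less.prems(3,4) and C = less.prems(5) and sized = less.prems(6)
  have ps: "pspace (block_space P)" using P R by (rule pspace_block_space)
  show ?case
  proof (cases "\<exists>X\<in>set_pmf P. m X \<noteq> 0")
    case False
    \<comment> \<open>Size 0 excludes rule \<open>step\<close>, whose size is a successor.\<close>
    have fA: "c A \<in> Val \<times> UNIV \<and> f A = return_pmf (c A)" if "A \<in> set_pmf P" for A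
      using sized[OF that] False that by (cases rule: sized_bigstep.cases) auto
    obtain A0 where A0: "A0 \<in> set_pmf P" using set_pmf_not_empty[of P] by (metis ex_in_conv)
    have d: "c A0 \<in> Val \<times> UNIV" using fA[OF A0] by (rule conjunct1)
    \<comment> \<open>Rule \<open>val\<close> demands values at every point but agreement only
      almost surely. Off the blocks \<open>C\<close> may be no value, so the value of an arbitrary
      block is put there.\<close>
    define C' where "C' \<rho> = (if \<rho> \<in> \<Union>(set_pmf P) then C \<rho> else c A0)" for \<rho>
    have C': "C' \<rho> = c A" if "A \<in> set_pmf P" "\<rho> \<in> A" for A \<rho>
      using C[OF that] that by (auto simp: C'_def)
    have "C' \<rho> \<in> Val \<times> UNIV" for \<rho>
    proof (cases "\<rho> \<in> \<Union>(set_pmf P)")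
      case True
      then obtain A where "A \<in> set_pmf P" "\<rho> \<in> A" by blast
      then show ?thesis using C' fA by metis
    qed (use d in \<open>simp add: C'_def\<close>)
    moreover have "emeasure (block_space P) {\<rho>. C \<rho> = C' \<rho>} = 1"
    proof -
      have "\<forall>A\<in>set_pmf P. A \<subseteq> {\<rho>. C \<rho> = C' \<rho>}" using C C' by auto
      moreover from this have "{\<rho>. C \<rho> = C' \<rho>} \<in> block_sets P" by (simp add: block_sets_def)
      ultimately show ?thesis using emeasure_block_space_eq_1_iff[OF P(1)] by blast
    qed
    ultimately have "bigstep Val step (block_space P, C) (block_space P, C')"
      using ps by (intro bigstep.val) simp_all
    moreover have "bind_pmf P f = map_pmf c P"
      unfolding map_pmf_def using fA by (intro bind_pmf_cong) simp_all
    ultimately show ?thesis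
      using ps distr_block_space[OF P(1), of C' c] C' by metis
  next
    case True
    then obtain X where X: "X \<in> set_pmf P" and mX: "m X \<noteq> 0" by blast
    from sized[OF X] mX obtain c1 c2 p \<mu>1 \<mu>2 n1 n2 where st: "step (c X) c1 c2 p"
      and s1: "sized_bigstep Val step c1 \<mu>1 n1" and s2: "p \<noteq> 1 \<longrightarrow> sized_bigstep Val step c2 \<mu>2 n2"
      and fX: "f X = mix_pmf p \<mu>1 \<mu>2" and n: "m X = Suc (n1 + n2)"
      by (cases rule: sized_bigstep.cases) auto
    have p: "0 < p" "p \<le> 1" using language.step_prob[OF lang st] by simp_all
    obtain r where r: "r \<notin> R" using inf R(1) by (meson ex_new_if_finite)
    have dep: "depends_on (- {r}) A" if "A \<in> set_pmf P" for A
      using R(2)[OF that] by (rule depends_on_mono) (use r in auto)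
    define Q where "Q = split_pmf P X r p"
    define T where "T = half X r True"
    define F where "F = half X r False"
    have neX: "X \<noteq> {}" by (rule block_pmf_nonempty[OF P(1) X])
    have TF: "T \<noteq> F"
      unfolding T_def F_def by (rule half_neq) (rule half_nonempty[OF dep[OF X] neX])
    \<comment> \<open>Keeps the case distinctions in \<open>c'\<close>, \<open>f'\<close> and
      \<open>m'\<close> from overwriting the data of a block that was not split.\<close>
    have not_half: "A \<noteq> T" "A \<noteq> F" if "A \<in> set_pmf P" "A \<noteq> X" for A
      using half_not_in[OF P X dep, of True] half_not_in[OF P X dep, of False] that
      unfolding T_def F_def by metis+
    have Q_cases: "A = T \<or> A = F \<and> p \<noteq> 1 \<or> A \<in> set_pmf P \<and> A \<noteq> X"
      if "A \<in> set_pmf Q" for A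
      using that unfolding Q_def
    proof (cases rule: set_split_pmf_cases)
      case (half b)
      then show ?thesis
        using bernoulli_pmf_support(2)[OF p] by (cases b) (simp_all add: T_def F_def)
    qed simp
    \<comment> \<open>For \<open>p = 1\<close> the choice of \<open>c2\<close> where the bit is
      \<open>False\<close> is harmless, as that half becomes a null set.\<close>
    define C2 where "C2 \<rho> = (if \<rho> \<in> X then if \<rho> r then c1 else c2 else C \<rho>)" for \<rho>
    define c' where "c' A = (if A = T then c1 else if A = F then c2 else c A)" for A
    define f' where "f' A = (if A = T then \<mu>1 else if A = F then \<mu>2 else f A)" for A
    define m' where "m' A = (if A = T then n1 else if A = F then n2 else m A)" for A
    have Q: "block_pmf Q" "finite (set_pmf Q)"
      unfolding Q_def by (rule block_pmf_split[OF P X dep] finite_set_split_pmf[OF P X dep]; assumption)+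
    have RQ: "depends_on (insert r R) A" if "A \<in> set_pmf Q" for A
      using that unfolding Q_def
    proof (cases rule: set_split_pmf_cases)
      case other
      show ?thesis using R(2)[OF other(1)] by (rule depends_on_mono) auto
    next
      case (half b)
      show ?thesis unfolding half(1) by (rule depends_on_half[OF R(2)[OF X]])
    qed
    have psQ: "pspace (block_space Q)"
      using Q _ RQ by (rule pspace_block_space) (use R(1) in simp)
    have other: "C2 \<rho> = C \<rho>" if "Y \<in> set_pmf P" "Y \<noteq> X" "\<rho> \<in> Y" for Y \<rho>
    proof -
      have "\<rho> \<notin> X" using block_pmf_disjoint[OF P(1) that(1) X that(2)] that(3) by blast
      then show ?thesis by (simp add: C2_def)
    qed
    have C2: "C2 \<rho> = c' A" if "A \<in> set_pmf Q" "\<rho> \<in> A" for A \<rho>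
      using Q_cases[OF that(1)]
    proof (elim disjE conjE)
      assume "A = T"
      then show ?thesis using that(2) by (simp add: C2_def c'_def T_def half_def)
    next
      assume A: "A = F"
      then have "\<rho> \<in> X" "\<not> \<rho> r" using that(2) by (simp_all add: F_def half_def)
      then show ?thesis using A TF by (simp add: C2_def c'_def)
    next
      assume A: "A \<in> set_pmf P" "A \<noteq> X"
      then show ?thesis using other[OF A that(2)] C[OF A(1) that(2)] not_half[OF A] by (simp add: c'_def)
    qed
    have sized': "sized_bigstep Val step (c' A) (f' A) (m' A)" if "A \<in> set_pmf Q" for A
      using Q_cases[OF that]
    proof (elim disjE conjE)
      assume "A = T"
      then show ?thesis using s1 by (simp add: c'_def f'_def m'_def)
    next
      assume "A = F" "p \<noteq> 1"
      then show ?thesis using s2 TF by (simp add: c'_def f'_def m'_def)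
    next
      assume A: "A \<in> set_pmf P" "A \<noteq> X"
      then show ?thesis using sized[OF A(1)] not_half[OF A] by (simp add: c'_def f'_def m'_def)
    qed
    have smaller: "(\<Sum>A\<in>set_pmf Q. m' A) < (\<Sum>A\<in>set_pmf P. m A)"
    proof -
      have "T \<notin> set_pmf P - {X}" "F \<notin> set_pmf P - {X}" using not_half by blast+
      \<comment> \<open>Only an inclusion, since for \<open>p = 1\<close> the set \<open>F\<close>
        is no block of \<open>Q\<close>. Its term \<open>n2\<close> may still be counted, because
        the size of \<open>X\<close> is \<open>Suc (n1 + n2)\<close>.\<close>
      moreover have "set_pmf Q \<subseteq> insert T (insert F (set_pmf P - {X}))" using Q_cases by blast
      then have "(\<Sum>A\<in>set_pmf Q. m' A) \<le> (\<Sum>A\<in>insert T (insert F (set_pmf P - {X})). m' A)"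
        using P(2) by (intro sum_mono2) simp_all
      ultimately have "(\<Sum>A\<in>set_pmf Q. m' A) \<le> m' T + (m' F + (\<Sum>A\<in>set_pmf P - {X}. m' A))"
        using P(2) TF by (simp del: insert_Diff_single)
      also have "(\<Sum>A\<in>set_pmf P - {X}. m' A) = (\<Sum>A\<in>set_pmf P - {X}. m A)"
        using not_half by (intro sum.cong) (auto simp: m'_def)
      finally show ?thesis
        using sum.remove[OF P(2) X, of m] n TF by (simp add: m'_def)
    qed
    have "finite (insert r R)" using R(1) by simp
    from less.hyps[OF smaller Q this, where C = C2 and c = c' and f = f'] RQ C2 sized'
    have "\<exists>\<psi> C'. pspace \<psi> \<and> C' \<in> \<psi> \<rightarrow>\<^sub>M count_space UNIV \<and>
      distr \<psi> (count_space UNIV) C' = measure_pmf (bind_pmf Q f') \<and>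
      bigstep Val step (block_space Q, C2) (\<psi>, C')"
      by simp
    then obtain \<psi> C' where IH: "pspace \<psi>" "C' \<in> \<psi> \<rightarrow>\<^sub>M count_space UNIV"
      "distr \<psi> (count_space UNIV) C' = measure_pmf (bind_pmf Q f')"
      "bigstep Val step (block_space Q, C2) (\<psi>, C')"
      by (elim exE conjE) (rule that, assumption+)
    have "bind_pmf Q f' = bind_pmf P f"
      unfolding Q_def bind_split_pmf
    proof (rule bind_pmf_cong[OF refl])
      fix A assume A: "A \<in> set_pmf P"
      show "(if X = A then mix_pmf p (f' (half X r True)) (f' (half X r False)) else f' A) = f A"
        using not_half[OF A] TF fX unfolding T_def[symmetric] F_def[symmetric] by (auto simp: f'_def)
    qed
    moreover have "cstep step (block_space P, C) (block_space Q, C2)"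
      unfolding Q_def
    proof (rule cstepI[OF lang P ps psQ[unfolded Q_def] X dep])
      fix \<rho> assume \<rho>: "\<rho> \<in> X"
      show "step (C \<rho>) c1 c2 p" using st C[OF X \<rho>] by simp
      show "C2 (\<rho>(r := True)) = c1" "C2 (\<rho>(r := False)) = c2"
        using depends_on_fun_upd[OF dep[OF X] \<rho>] by (simp_all add: C2_def)
    qed (use other in \<open>assumption | simp\<close>)+
    ultimately show ?thesis
      using IH by (metis bigstep.step)
  qed
qed

theorem mainTheorem2:
  fixes Val :: "'e set"
    and step :: "('e, 's) step_rel"
    and e :: 'e and \<sigma> :: 's
    and \<mu> :: "('e, 's) config pmf"
  assumes "language step"
    and "infinite (UNIV :: 'r::countable set)"
    and "set_pmf \<mu> \<subseteq> Val \<times> UNIV"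
  shows "(std_bigstep Val step (e, \<sigma>) \<mu> \<longrightarrow>
            (\<exists>(\<psi> :: ('r \<Rightarrow> bool) measure) C.
               pspace \<psi> \<and> C \<in> \<psi> \<rightarrow>\<^sub>M count_space UNIV \<and>
               measure_pmf \<mu> = distr \<psi> (count_space UNIV) C \<and>
               bigstep Val step (psi0, \<lambda>\<rho>. (e, \<sigma>)) (\<psi>, C)))
       \<and> (\<forall>(\<psi> :: ('r \<Rightarrow> bool) measure) C.
            bigstep Val step (psi0, \<lambda>\<rho>. (e, \<sigma>)) (\<psi>, C) \<longrightarrow>
            (\<exists>\<mu>'. measure_pmf \<mu>' = distr \<psi> (count_space UNIV) C \<and>
                  std_bigstep Val step (e, \<sigma>) \<mu>'))"
proof (intro conjI impI allI)
  let ?P = "return_pmf UNIV :: ('r \<Rightarrow> bool) set pmf"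
  have P: "block_pmf ?P" by (rule block_pmf_return) simp
  show "\<exists>(\<psi> :: ('r \<Rightarrow> bool) measure) C.
      pspace \<psi> \<and> C \<in> \<psi> \<rightarrow>\<^sub>M count_space UNIV \<and>
      measure_pmf \<mu> = distr \<psi> (count_space UNIV) C \<and>
      bigstep Val step (psi0, \<lambda>\<rho>. (e, \<sigma>)) (\<psi>, C)"
    if std: "std_bigstep Val step (e, \<sigma>) \<mu>"
  proof -
    obtain n where n: "sized_bigstep Val step (e, \<sigma>) \<mu> n"
      using std_bigstep_imp_sized[OF std] by blast
    \<comment> \<open>The only initial block is the whole sample space, so the run starts with no
      used bits.\<close>
    have dep: "depends_on {} A" if "A \<in> set_pmf ?P" for A
      using that by (simp add: depends_on_iff)
    have "\<exists>\<psi> C'. pspace \<psi> \<and> C' \<in> \<psi> \<rightarrow>\<^sub>M count_space UNIV \<and>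
        distr \<psi> (count_space UNIV) C' = measure_pmf (bind_pmf ?P (\<lambda>_. \<mu>)) \<and>
        bigstep Val step (block_space ?P, \<lambda>\<rho>. (e, \<sigma>)) (\<psi>, C')"
      by (rule sized_bigstep_imp_bigstep[OF assms(1,2) P _ finite.emptyI dep, of _ "\<lambda>_. (e, \<sigma>)" _ _ "\<lambda>_. n"])
        (simp_all add: n)
    then show ?thesis
      unfolding psi0_eq_block_space bind_return_pmf by metis
  qed
  show "\<exists>\<mu>'. measure_pmf \<mu>' = distr \<psi> (count_space UNIV) C \<and> std_bigstep Val step (e, \<sigma>) \<mu>'"
    if big: "bigstep Val step (psi0, \<lambda>\<rho>. (e, \<sigma>)) (\<psi>, C)" for \<psi> :: "('r \<Rightarrow> bool) measure" and C
  proof -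
    obtain f where "\<forall>A\<in>set_pmf ?P. \<forall>\<rho>\<in>A. std_bigstep Val step (e, \<sigma>) (f A)"
      "distr \<psi> (count_space UNIV) C = measure_pmf (bind_pmf ?P f)"
      using bigstep_imp_std_bigstep[OF assms(1) big P] psi0_eq_block_space by auto
    then show ?thesis by (intro exI[of _ "f UNIV"]) (simp add: bind_return_pmf)
  qed
qed

end
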